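(* Let $G$ be a graph of order $n\ge 2$, with the convention that $\mathcal K(H)=\infty$ when $H$ is disconnected. Then $$\min\{\mathcal K(G),\mathcal K(\overline G)\}\le (8+2\sqrt5)\,n-(10+2\sqrt5).$$ In particular, $\min\{\mathcal K(G),\mathcal K(\overline G)\}=O(n)$ (with an absolute implied constant).
   Context: All graphs are finite, simple, undirected and unweighted; $G$ is not assumed connected here. The order of a graph is its number of vertices. The complement $\overline G$ is the graph on $V(G)$ in which two distinct vertices are adjacent if and only if they are nonadjacent in $G$. For a connected graph $H$ with $m\ge 1$ edges, Kemeny's constant is $\mathcal K(H)=\sum_{j\in V(H)}\frac{d_H(j)}{2m}E_iT_j$, where $d_H(j)$ is the degree of $j$ and $E_iT_j$ is the expected hitting time of $j$ for the simple random walk on $H$ started at $i$ (with $E_iT_i=0$); this does not depend on $i$. Equivalently, $\mathcal K(H)=\frac1{4m}\sum_{u\in V(H)}\sum_{v\in V(H)}d_H(u)d_H(v)r_H(u,v)$, where $r_H(u,v)$ is the effective resistance between $u$ and $v$ when each edge is a $1$-ohm resistor; also equivalently, $\mathcal K(H)=\sum_{i=2}^{n} 1/\lambda_i$, where $n=|V(H)|$ and $0=\lambda_1<\lambda_2\le\dots\le\lambda_n$ are the eigenvalues of the normalized Laplacian $I-D^{-1/2}AD^{-1/2}$ ($A$ the adjacency matrix and $D$ the diagonal degree matrix of $H$). *)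

theory Defs
  imports "HOL-Probability.Probability" "Graph_Theory.Graph_Theory"
begin

text \<open>
  Finite simple undirected graphs are the \<open>pair_graph\<close>s of the Graph_Theory entry: a finite vertex
  set with a symmetric irreflexive adjacency relation. Each undirected edge \<open>{u, v}\<close> is represented
  by the two arcs \<open>(u, v)\<close> and \<open>(v, u)\<close>, so a graph with \<open>m\<close> edges has \<open>2 * m\<close> arcs, and
  the degree of a vertex is its out-degree.
\<close>

definition complement_graph :: "'a pair_pre_digraph \<Rightarrow> 'a pair_pre_digraph" where
  "complement_graph G =
     \<lparr> pverts = pverts G,
       parcs = {(u, v). u \<in> pverts G \<and> v \<in> pverts G \<and> u \<noteq> v \<and> (u, v) \<notin> parcs G} \<rparr>"

lemma pair_graph_complement_graph:
  assumes "pair_graph G"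
  shows "pair_graph (complement_graph G)"
proof -
  interpret pair_graph G by fact
  have "finite (parcs (complement_graph G))"
    by (rule finite_subset[of _ "pverts G \<times> pverts G"])
       (auto simp: complement_graph_def pair_finite_verts)
  moreover have "(v, u) \<in> parcs G" if "(u, v) \<in> parcs G" for u v
    using pair_sym_arcs that by (auto simp: symmetric_def dest: symD)
  ultimately show ?thesis
    by unfold_locales
       (auto simp: complement_graph_def pair_finite_verts symmetric_def intro!: symI)
qed

definition neighbours :: "'a pair_pre_digraph \<Rightarrow> 'a \<Rightarrow> 'a set" where
  "neighbours H v = {w. (v, w) \<in> parcs H}"

definition vertex_degree :: "'a pair_pre_digraph \<Rightarrow> 'a \<Rightarrow> nat" where
  "vertex_degree H v = out_degree (with_proj H) v"

lemma vertex_degree_eq_card_neighbours: "vertex_degree H v = card (neighbours H v)"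
proof -
  have "out_arcs (with_proj H) v = Pair v ` neighbours H v"
    by (auto simp: out_arcs_def neighbours_def)
  then show ?thesis
    by (simp add: vertex_degree_def out_degree_def card_image inj_on_def)
qed

text \<open>
  The simple random walk is realised on a sequence of independent, identically distributed
  random maps. Each map is uniform among all choices of one neighbour for every vertex, i.e. it
  sends the vertices to independent uniformly chosen neighbours; the \<open>t\<close>-th map of the sequence
  decides the \<open>t\<close>-th step. The lemma \<open>prob_walk\<close> below confirms that the resulting process is
  the Markov chain moving from \<open>u\<close> to each neighbour of \<open>u\<close> with probability \<open>1 / vertex_degree H u\<close>.
\<close>

definition step_space :: "'a pair_pre_digraph \<Rightarrow> ('a \<Rightarrow> 'a) measure" where
  "step_space H = uniform_count_measure (\<Pi>\<^sub>E v\<in>pverts H. neighbours H v)"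

definition walk_space :: "'a pair_pre_digraph \<Rightarrow> ('a \<Rightarrow> 'a) stream measure" where
  "walk_space H = stream_space (step_space H)"

primrec walk :: "'a \<Rightarrow> ('a \<Rightarrow> 'a) stream \<Rightarrow> nat \<Rightarrow> 'a" where
  "walk i \<omega> 0 = i"
| "walk i \<omega> (Suc t) = (\<omega> !! t) (walk i \<omega> t)"

definition hitting_time :: "'a \<Rightarrow> 'a \<Rightarrow> ('a \<Rightarrow> 'a) stream \<Rightarrow> ennreal" where
  "hitting_time i j \<omega> = (INF t\<in>{t. walk i \<omega> t = j}. of_nat t)"

definition expected_hitting_time :: "'a pair_pre_digraph \<Rightarrow> 'a \<Rightarrow> 'a \<Rightarrow> ennreal" where
  "expected_hitting_time H i j = (\<integral>\<^sup>+ \<omega>. hitting_time i j \<omega> \<partial>walk_space H)"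

text \<open>
  The denominator \<open>card (parcs H)\<close> is twice the number of edges. The value does not depend
  on the start vertex \<open>i\<close> when the graph is connected; a disconnected graph has the value
  \<open>\<infinity>\<close> by convention.
\<close>

definition kemeny :: "'a pair_pre_digraph \<Rightarrow> ennreal" where
  "kemeny H =
     (if Digraph_Component.connected (with_proj H)
      then let i = (SOME i. i \<in> pverts H)
           in \<Sum>j\<in>pverts H. ennreal (real (vertex_degree H j) / real (card (parcs H)))
                              * expected_hitting_time H i j
      else \<infinity>)"

context
  fixes H :: "'a pair_pre_digraph"
  assumes H: "pair_graph H" and no_isolated: "\<And>v. v \<in> pverts H \<Longrightarrow> neighbours H v \<noteq> {}"
begin

lemma finite_verts: "finite (pverts H)"
  using H by (simp add: pair_graph_def pair_digraph_def pair_fin_digraph_def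
      pair_fin_digraph_axioms_def)

lemma neighbours_subset: "neighbours H v \<subseteq> pverts H"
  using pair_wf_digraph.in_arcsD2[of H] H
  by (auto simp: neighbours_def pair_graph_def pair_digraph_def pair_fin_digraph_def)

lemma finite_steps: "finite (\<Pi>\<^sub>E v\<in>pverts H. neighbours H v)"
  using finite_verts finite_subset[OF neighbours_subset] by (intro finite_PiE) auto

lemma steps_nonempty: "(\<Pi>\<^sub>E v\<in>pverts H. neighbours H v) \<noteq> {}"
  using no_isolated by (auto simp: PiE_eq_empty_iff)

lemma prob_space_step_space: "prob_space (step_space H)"
  unfolding step_space_def using finite_steps steps_nonempty
  by (rule prob_space_uniform_count_measure)

lemma prob_space_walk_space: "prob_space (walk_space H)"
  unfolding walk_space_def
  using prob_space_step_space by (rule prob_space.prob_space_stream_space)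

lemma space_step_space: "space (step_space H) = (\<Pi>\<^sub>E v\<in>pverts H. neighbours H v)"
  by (simp add: step_space_def space_uniform_count_measure)

lemma sets_step_space: "sets (step_space H) = Pow (\<Pi>\<^sub>E v\<in>pverts H. neighbours H v)"
  by (simp add: step_space_def sets_uniform_count_measure)

lemma measurable_walk:
  assumes "i \<in> pverts H"
  shows "(\<lambda>\<omega>. walk i \<omega> t) \<in> walk_space H \<rightarrow>\<^sub>M count_space (pverts H)"
proof (induction t)
  case 0
  then show ?case using assms by simp
next
  case (Suc t)
  have "(\<lambda>\<omega>. (\<omega> !! t) u) \<in> walk_space H \<rightarrow>\<^sub>M count_space (pverts H)" if "u \<in> pverts H" for u
  proof -
    have "(\<lambda>f. f u) \<in> step_space H \<rightarrow>\<^sub>M count_space (pverts H)"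
      using that neighbours_subset
      by (auto simp: measurable_def space_step_space sets_step_space)
    then show ?thesis
      unfolding walk_space_def by (rule measurable_compose[OF measurable_snth])
  qed
  then show ?case
    by (simp, intro measurable_compose_countable'[where f = "\<lambda>u \<omega>. (\<omega> !! t) u"
          and g = "\<lambda>\<omega>. walk i \<omega> t" and I = "pverts H"] Suc countable_finite finite_verts)
qed

lemma pred_walk:
  assumes "i \<in> pverts H"
  shows "Measurable.pred (walk_space H) (\<lambda>\<omega>. walk i \<omega> t = j)"
  by (rule measurable_compose[OF measurable_walk[OF assms]]) simp

lemma measurable_hitting_time:
  assumes "i \<in> pverts H"
  shows "hitting_time i j \<in> borel_measurable (walk_space H)"
proof -
  have pred: "Measurable.pred (walk_space H) (\<lambda>\<omega>. walk i \<omega> t = j)" for t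
    using assms by (rule pred_walk)
  have eq: "hitting_time i j = (\<lambda>\<omega>. INF t. if walk i \<omega> t = j then of_nat t else top)"
  proof
    fix \<omega>
    show "hitting_time i j \<omega> = (INF t. if walk i \<omega> t = j then of_nat t else top)"
      unfolding hitting_time_def
    proof (intro antisym INF_greatest)
      fix t
      show "(INF t\<in>{t. walk i \<omega> t = j}. of_nat t) \<le> (if walk i \<omega> t = j then of_nat t else top :: ennreal)"
        by (auto intro: INF_lower)
    next
      fix t assume "t \<in> {t. walk i \<omega> t = j}"
      then show "(INF t. if walk i \<omega> t = j then of_nat t else top :: ennreal) \<le> of_nat t"
        by (intro INF_lower2[of t]) auto
    qed
  qed
  show ?thesis
    unfolding eq using pred by measurable
qed

lemma prob_step:
  assumes "u \<in> pverts H"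
  shows "measure (step_space H) {f \<in> space (step_space H). f u = w} =
           (if (u, w) \<in> parcs H then 1 / real (vertex_degree H u) else 0)"
proof -
  define N where "N = (\<lambda>v. if v = u then neighbours H u \<inter> {w} else neighbours H v)"
  have set_eq: "{f \<in> space (step_space H). f u = w} = (\<Pi>\<^sub>E v\<in>pverts H. N v)"
  proof (intro set_eqI iffI)
    fix f assume "f \<in> {f \<in> space (step_space H). f u = w}"
    then show "f \<in> (\<Pi>\<^sub>E v\<in>pverts H. N v)"
      using assms by (auto simp: space_step_space N_def PiE_iff)
  next
    fix f assume f: "f \<in> (\<Pi>\<^sub>E v\<in>pverts H. N v)"
    then have "f u = w" using assms by (force simp: N_def PiE_iff)
    moreover have "f v \<in> neighbours H v" if "v \<in> pverts H" for v
    proof -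
      from f that have "f v \<in> N v" by (simp add: PiE_iff)
      then show ?thesis by (auto simp: N_def split: if_splits)
    qed
    ultimately show "f \<in> {f \<in> space (step_space H). f u = w}"
      using f by (simp add: space_step_space PiE_iff)
  qed
  have sub: "(\<Pi>\<^sub>E v\<in>pverts H. N v) \<subseteq> (\<Pi>\<^sub>E v\<in>pverts H. neighbours H v)"
    by (intro PiE_mono) (auto simp: N_def)
  define P where "P = (\<Prod>v\<in>pverts H - {u}. card (neighbours H v))"
  have "measure (step_space H) {f \<in> space (step_space H). f u = w} =
          real (card (\<Pi>\<^sub>E v\<in>pverts H. N v)) / real (card (\<Pi>\<^sub>E v\<in>pverts H. neighbours H v))"
    by (subst set_eq, unfold step_space_def)
      (rule measure_uniform_count_measure[OF finite_steps sub])
  also have "card (\<Pi>\<^sub>E v\<in>pverts H. N v) = card (neighbours H u \<inter> {w}) * P"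
    using assms finite_verts by (simp add: card_PiE prod.remove[of _ u] N_def P_def)
  also have "card (\<Pi>\<^sub>E v\<in>pverts H. neighbours H v) = vertex_degree H u * P"
    using assms finite_verts
    by (simp add: card_PiE prod.remove[of _ u] P_def vertex_degree_eq_card_neighbours)
  also have "card (neighbours H u \<inter> {w}) = (if (u, w) \<in> parcs H then 1 else 0)"
    by (auto simp: neighbours_def)
  also have "P \<noteq> 0"
    using no_isolated finite_subset[OF neighbours_subset finite_verts] finite_verts
    by (auto simp: P_def)
  then have "real ((if (u, w) \<in> parcs H then 1 else 0) * P) / real (vertex_degree H u * P) =
      (if (u, w) \<in> parcs H then 1 / real (vertex_degree H u) else 0)"
    by simp
  finally show ?thesis .
qed

lemma walk_Stream: "walk i (f ## \<omega>) (Suc t) = walk (f i) \<omega> t"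
  by (induction t) auto

lemma prob_walk:
  assumes "i \<in> pverts H" "x 0 = i"
  shows "measure (walk_space H) {\<omega> \<in> space (walk_space H). \<forall>k\<le>t. walk i \<omega> k = x k} =
           (\<Prod>k<t. if (x k, x (Suc k)) \<in> parcs H then 1 / real (vertex_degree H (x k)) else 0)"
  using assms
proof (induction t arbitrary: i x)
  case 0
  interpret prob_space "walk_space H" by (rule prob_space_walk_space)
  show ?case using 0 prob_space by simp
next
  case (Suc t)
  interpret S: prob_space "step_space H" by (rule prob_space_step_space)
  interpret W: prob_space "walk_space H" by (rule prob_space_walk_space)
  define A where "A = (\<lambda>i x t. {\<omega> \<in> space (walk_space H). \<forall>k\<le>t. walk i \<omega> k = x k})"
  have A_sets: "A i x t \<in> sets (walk_space H)" if "i \<in> pverts H" for i t and x :: "nat \<Rightarrow> 'a"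
  proof -
    have [measurable]: "Measurable.pred (walk_space H) (\<lambda>\<omega>. walk i \<omega> k = x k)" for k
      using that by (rule pred_walk)
    then show ?thesis unfolding A_def by measurable
  qed
  have space_Stream: "f ## \<omega> \<in> space (walk_space H)"
    if "f \<in> space (step_space H)" "\<omega> \<in> space (walk_space H)" for f \<omega>
    using that by (simp add: walk_space_def stream_space_Stream)
  have A_Stream: "f ## \<omega> \<in> A i x (Suc t) \<longleftrightarrow> f i = x 1 \<and> \<omega> \<in> A (x 1) (x \<circ> Suc) t"
    if "f \<in> space (step_space H)" "\<omega> \<in> space (walk_space H)" for f \<omega>
    using that space_Stream[OF that] Suc.prems
    by (simp add: A_def less_Suc_eq_le[symmetric] All_less_Suc2 walk_Stream del: walk.simps(2))
       (auto simp: All_less_Suc2)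
  let ?B = "{f \<in> space (step_space H). f i = x 1}"
  have B_sets: "?B \<in> sets (step_space H)"
    by (auto simp: sets_step_space space_step_space)
  have "emeasure (walk_space H) (A i x (Suc t)) =
          (\<integral>\<^sup>+ \<omega>. indicator (A i x (Suc t)) \<omega> \<partial>walk_space H)"
    by (simp add: A_sets Suc.prems(1))
  also have "\<dots> = (\<integral>\<^sup>+ f. \<integral>\<^sup>+ \<omega>. indicator (A i x (Suc t)) (f ## \<omega>) \<partial>walk_space H \<partial>step_space H)"
    using A_sets[OF Suc.prems(1), of x "Suc t"] unfolding walk_space_def
    by (intro S.nn_integral_stream_space) simp
  also have "\<dots> = (\<integral>\<^sup>+ f. indicator ?B f *
      emeasure (walk_space H) (A (x 1) (x \<circ> Suc) t) \<partial>step_space H)"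
  proof (rule nn_integral_cong)
    fix f assume f: "f \<in> space (step_space H)"
    show "(\<integral>\<^sup>+ \<omega>. indicator (A i x (Suc t)) (f ## \<omega>) \<partial>walk_space H) =
        indicator ?B f * emeasure (walk_space H) (A (x 1) (x \<circ> Suc) t)"
    proof (cases "f i = x 1")
      case True
      then have "x 1 \<in> pverts H"
        using f Suc.prems(1) neighbours_subset by (force simp: space_step_space PiE_iff)
      then have m: "A (x 1) (x \<circ> Suc) t \<in> sets (walk_space H)" by (rule A_sets)
      have "(\<integral>\<^sup>+ \<omega>. indicator (A i x (Suc t)) (f ## \<omega>) \<partial>walk_space H) =
          (\<integral>\<^sup>+ \<omega>. indicator (A (x 1) (x \<circ> Suc) t) \<omega> \<partial>walk_space H)"
        using True by (intro nn_integral_cong) (simp add: A_Stream[OF f] indicator_def)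
      with True f m show ?thesis by simp
    next
      case False
      then have "(\<integral>\<^sup>+ \<omega>. indicator (A i x (Suc t)) (f ## \<omega>) \<partial>walk_space H) =
          (\<integral>\<^sup>+ \<omega>. 0 \<partial>walk_space H)"
        by (intro nn_integral_cong) (simp add: A_Stream[OF f] indicator_def)
      with False show ?thesis by simp
    qed
  qed
  also have "\<dots> = emeasure (step_space H) ?B * emeasure (walk_space H) (A (x 1) (x \<circ> Suc) t)"
    using B_sets by (simp add: nn_integral_multc)
  finally have "measure (walk_space H) (A i x (Suc t)) =
      measure (step_space H) ?B * measure (walk_space H) (A (x 1) (x \<circ> Suc) t)"
    by (simp add: measure_def enn2real_mult)
  also have "measure (step_space H) ?B = (if (i, x 1) \<in> parcs H then 1 / real (vertex_degree H i) else 0)"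
    by (rule prob_step[OF Suc.prems(1)])
  also have "\<dots> * measure (walk_space H) (A (x 1) (x \<circ> Suc) t) =
      (\<Prod>k<Suc t. if (x k, x (Suc k)) \<in> parcs H then 1 / real (vertex_degree H (x k)) else 0)"
  proof (cases "(i, x 1) \<in> parcs H")
    case True
    then have "x 1 \<in> pverts H" using neighbours_subset by (auto simp: neighbours_def)
    from Suc.IH[OF this, of "x \<circ> Suc", unfolded comp_def] True Suc.prems(2) show ?thesis
      by (simp add: A_def comp_def prod.lessThan_Suc_shift del: prod.lessThan_Suc)
  next
    case False
    then show ?thesis
      using Suc.prems(2) by (simp add: prod.lessThan_Suc_shift del: prod.lessThan_Suc)
  qed
  finally show ?case by (simp add: A_def)
qed

end

end

theory Submission
  imports Defs
begin

text \<open>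
  Kemeny's constant is \<open>1 / (4 m)\<close> times the sum of \<open>d(u) d(v) r(u, v)\<close> over all pairs of vertices, where \<open>r\<close>
  is the effective resistance. If \<open>r(u, v) \<le> 10 (1 / d(u) + 1 / d(v))\<close> for all pairs, each term with
  \<open>u \<noteq> v\<close> is at most \<open>10 (d(u) + d(v))\<close>, and the constant is at most \<open>10 (n - 1)\<close>. So it suffices that
  one of \<open>G\<close> and its complement has this property, called \<open>degree_bounded_resistances\<close> below.

  Suppose that a pair \<open>x, y\<close> violates the inequality in the complement, and let \<open>S\<close>, \<open>T\<close> be the
  neighbourhoods of \<open>x\<close>, \<open>y\<close> there, with \<open>s\<close> and \<open>t\<close> elements. A vertex \<open>w\<close> that is adjacent in the
  complement to a fifth of \<open>S\<close> and to a fifth of \<open>T\<close> would connect \<open>x\<close> to \<open>y\<close> too well, and so would many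
  edges of the complement between \<open>S\<close> and \<open>T\<close>. Hence in \<open>G\<close> every vertex is adjacent to more than four
  fifths of \<open>S\<close> or of \<open>T\<close>, and \<open>S\<close> is densely connected to \<open>T\<close>. Two vertices of the same kind have many
  common neighbours; moreover \<open>y\<close> is of the first kind, \<open>x\<close> of the second, and the edges between \<open>S\<close> and
  \<open>T\<close> connect \<open>y\<close> to \<open>x\<close>. Thus \<^emph>\<open>all\<close> resistances in \<open>G\<close> are at most \<open>10 (1 / s + 1 / t)\<close>; this is
  \<open>resistance_le_of_complement\<close>. If \<open>G\<close> also had a violating pair \<open>u, v\<close>, then by symmetry all resistances
  in the complement would be at most \<open>10 (1 / d(u) + 1 / d(v))\<close>. Whichever of the two bounds is smaller
  contradicts the violation in the other graph. The argument needs \<open>S\<close> and \<open>T\<close> nonempty; a vertex that is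
  isolated in one of the graphs is adjacent to everything in the other, and two-step paths through it
  give the inequality there.

  The link between resistances and the random walk, \<open>kemeny_le\<close>, comes from the first-step equations: they
  say that the expected hitting times, as functions of the starting vertex, have a prescribed Laplacian.
\<close>

section \<open>Dirichlet energy and effective resistance\<close>

lemma pair_graph_symD:
  assumes "pair_graph H" "(u, v) \<in> parcs H"
  shows "(v, u) \<in> parcs H"
proof -
  interpret pair_graph H by fact
  have "sym (parcs H)" using pair_sym_arcs by (simp add: symmetric_def)
  then show ?thesis using assms(2) by (rule symD)
qed

lemma pair_graph_irrefl:
  assumes "pair_graph H"
  shows "(u, u) \<notin> parcs H"
proof -
  interpret pair_graph H by fact
  show ?thesis using pair_no_loops[of "(u, u)"] by auto
qed

lemma pair_graph_arc_verts:
  assumes "pair_graph H" "(u, v) \<in> parcs H"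
  shows "u \<in> pverts H" "v \<in> pverts H"
proof -
  interpret pair_graph H by fact
  show "u \<in> pverts H" "v \<in> pverts H" using in_arcsD1[OF assms(2)] in_arcsD2[OF assms(2)] .
qed

lemma pair_graph_finite:
  assumes "pair_graph H"
  shows "finite (pverts H)" "finite (parcs H)" "finite (neighbours H v)"
proof -
  interpret pair_graph H by fact
  show "finite (pverts H)" "finite (parcs H)" by (simp_all add: pair_finite_verts pair_finite_arcs)
  show "finite (neighbours H v)"
    using pair_graph_arc_verts(2)[OF assms]
    by (intro finite_subset[OF _ pair_finite_verts]) (auto simp: neighbours_def)
qed

text \<open>The factor \<open>1 / 2\<close> makes every undirected edge count once.\<close>

definition energy :: "'a pair_pre_digraph \<Rightarrow> ('a \<Rightarrow> real) \<Rightarrow> real" where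
  "energy H f = (\<Sum>(x, y)\<in>parcs H. (f x - f y)\<^sup>2) / 2"

text \<open>
  By the Dirichlet principle the effective resistance between \<open>u\<close> and \<open>v\<close> is the least \<open>r\<close> with
  this property. Stated as an upper bound it needs no potential or flow to exist, and it also covers
  disconnected graphs: no \<open>r\<close> works when \<open>u\<close> and \<open>v\<close> lie in different components.
\<close>

definition resistance_le :: "'a pair_pre_digraph \<Rightarrow> 'a \<Rightarrow> 'a \<Rightarrow> real \<Rightarrow> bool" where
  "resistance_le H u v r \<longleftrightarrow> (\<forall>f. (f u - f v)\<^sup>2 \<le> r * energy H f)"

lemma energy_nonneg: "0 \<le> energy H f"
  unfolding energy_def by (auto intro!: divide_nonneg_nonneg sum_nonneg)

lemma resistance_le_mono: "resistance_le H u v r \<Longrightarrow> r \<le> r' \<Longrightarrow> resistance_le H u v r'"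
  unfolding resistance_le_def using energy_nonneg mult_right_mono order_trans by meson

lemma resistance_le_refl: "0 \<le> r \<Longrightarrow> resistance_le H u u r"
  by (simp add: resistance_le_def energy_nonneg)

lemma resistance_le_sym: "resistance_le H u v r \<Longrightarrow> resistance_le H v u r"
  by (simp add: resistance_le_def power2_commute)

text \<open>
  \<open>O1\<close> contains at most one orientation of each edge, so its terms count fully; \<open>F\<close> may contain both
  orientations, and then each of them accounts for half of the edge.
\<close>

lemma sum_le_energy:
  assumes H: "pair_graph H" and O: "O1 \<subseteq> parcs H" "O1 \<inter> O1\<inverse> = {}"
    and F: "F \<subseteq> parcs H" "F \<inter> O1 = {}" "F \<inter> O1\<inverse> = {}"
  shows "(\<Sum>(x, y)\<in>O1. (f x - f y)\<^sup>2) + (\<Sum>(x, y)\<in>F. (f x - f y)\<^sup>2) / 2 \<le> energy H f"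
proof -
  let ?d = "\<lambda>(x, y). (f x - f y)\<^sup>2 :: real"
  have fin: "finite (parcs H)" by (rule pair_graph_finite[OF H])
  have sub: "O1\<inverse> \<subseteq> parcs H" using O(1) pair_graph_symD[OF H] by auto
  have finO: "finite O1" "finite (O1\<inverse>)" "finite F" using fin O(1) F(1) sub finite_subset by blast+
  have rev: "sum ?d (O1\<inverse>) = sum ?d O1"
    by (rule sum.reindex_bij_witness[where i = prod.swap and j = prod.swap])
      (auto simp: power2_commute)
  have "sum ?d (O1 \<union> O1\<inverse> \<union> F) = sum ?d (O1 \<union> O1\<inverse>) + sum ?d F"
    using finO F(2,3) by (intro sum.union_disjoint) blast+
  also have "sum ?d (O1 \<union> O1\<inverse>) = sum ?d O1 + sum ?d (O1\<inverse>)"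
    using finO O(2) by (intro sum.union_disjoint)
  finally have "sum ?d O1 + sum ?d (O1\<inverse>) + sum ?d F = sum ?d (O1 \<union> O1\<inverse> \<union> F)" ..
  also have "\<dots> \<le> sum ?d (parcs H)"
    using O(1) F(1) sub by (intro sum_mono2 fin) auto
  finally show ?thesis using rev by (simp add: energy_def)
qed

lemma truncation_split: "(max a c - max b c)\<^sup>2 + (min a c - min b c)\<^sup>2 \<le> (a - b :: real)\<^sup>2"
proof -
  define x where "x = max a c - max b c"
  define y where "y = min a c - min b c"
  have "0 \<le> x * y"
    by (cases "a \<le> b") (auto intro!: mult_nonneg_nonneg mult_nonpos_nonpos simp: x_def y_def max_def min_def)
  then have "x\<^sup>2 + y\<^sup>2 \<le> (x + y)\<^sup>2" by (simp add: power2_sum)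
  moreover have "x + y = a - b" by (auto simp: x_def y_def max_def min_def)
  ultimately show ?thesis by (simp add: x_def y_def)
qed

lemma energy_truncation:
  "energy H (\<lambda>x. max (f x) c) + energy H (\<lambda>x. min (f x) c) \<le> energy H f"
proof -
  have "(\<Sum>e\<in>parcs H. (max (f (fst e)) c - max (f (snd e)) c)\<^sup>2
      + (min (f (fst e)) c - min (f (snd e)) c)\<^sup>2)
    \<le> (\<Sum>e\<in>parcs H. (f (fst e) - f (snd e))\<^sup>2)"
    by (rule sum_mono) (rule truncation_split)
  then show ?thesis
    unfolding energy_def case_prod_unfold sum.distrib add_divide_distrib[symmetric]
    by (rule divide_right_mono) simp
qed

text \<open>The Cauchy-Schwarz inequality, in the form in which resistances in series add up.\<close>

lemma cauchy_two_terms: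
  fixes a b :: real
  assumes "a\<^sup>2 \<le> r * x" "b\<^sup>2 \<le> s * y" "0 \<le> r" "0 \<le> s" "0 \<le> x" "0 \<le> y"
  shows "(a + b)\<^sup>2 \<le> (r + s) * (x + y)"
proof -
  have "(a * b)\<^sup>2 \<le> (r * x) * (s * y)"
    unfolding power_mult_distrib using assms by (intro mult_mono) auto
  also have "4 * \<dots> \<le> (r * y + s * x)\<^sup>2"
  proof -
    have "(r * y + s * x)\<^sup>2 - 4 * ((r * x) * (s * y)) = (r * y - s * x)\<^sup>2"
      by (simp add: power2_eq_square algebra_simps)
    moreover have "0 \<le> (r * y - s * x)\<^sup>2" by simp
    ultimately show ?thesis by linarith
  qed
  finally have "(2 * (a * b))\<^sup>2 \<le> (r * y + s * x)\<^sup>2" by (simp add: power_mult_distrib)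
  then have "2 * (a * b) \<le> r * y + s * x"
    by (rule power2_le_imp_le) (simp add: assms(3-6))
  then show ?thesis using assms(1,2) by (simp add: power2_sum algebra_simps)
qed

text \<open>
  Cutting a test function at its value at \<open>w\<close> splits its energy into the energy above and the energy
  below that level; one part pays for the drop from \<open>u\<close> to \<open>w\<close>, the other for the drop from \<open>w\<close>
  to \<open>v\<close>.
\<close>

lemma resistance_le_trans:
  assumes uw: "resistance_le H u w r" and wv: "resistance_le H w v s" and r: "0 \<le> r" and s: "0 \<le> s"
  shows "resistance_le H u v (r + s)"
  unfolding resistance_le_def
proof
  fix f
  have between: "(g a - g b)\<^sup>2 \<le> (p + q) * energy H g"
    if g: "g b \<le> g w" "g w \<le> g a" and aw: "resistance_le H a w p" and wb: "resistance_le H w b q"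
      and pq: "0 \<le> p" "0 \<le> q" for a b p q and g :: "'a \<Rightarrow> real"
  proof -
    have 1: "(g a - g w)\<^sup>2 \<le> p * energy H (\<lambda>x. max (g x) (g w))"
      using aw[unfolded resistance_le_def, rule_format, of "\<lambda>x. max (g x) (g w)"] g by simp
    have 2: "(g w - g b)\<^sup>2 \<le> q * energy H (\<lambda>x. min (g x) (g w))"
      using wb[unfolded resistance_le_def, rule_format, of "\<lambda>x. min (g x) (g w)"] g by simp
    have "(g a - g b)\<^sup>2 = ((g a - g w) + (g w - g b))\<^sup>2" by simp
    also have "\<dots> \<le> (p + q) * (energy H (\<lambda>x. max (g x) (g w)) + energy H (\<lambda>x. min (g x) (g w)))"
      by (rule cauchy_two_terms[OF 1 2 pq energy_nonneg energy_nonneg])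
    also have "\<dots> \<le> (p + q) * energy H g"
      using pq energy_truncation by (intro mult_left_mono) auto
    finally show ?thesis .
  qed
  have uw': "(f u - f w)\<^sup>2 \<le> r * energy H f" and wv': "(f w - f v)\<^sup>2 \<le> s * energy H f"
    using uw wv by (simp_all add: resistance_le_def)
  have rs: "r * energy H f \<le> (r + s) * energy H f" "s * energy H f \<le> (r + s) * energy H f"
    using r s by (simp_all add: distrib_right energy_nonneg)
  consider "f v \<le> f w" "f w \<le> f u" | "f u \<le> f w" "f w \<le> f v"
    | "\<bar>f u - f v\<bar> \<le> \<bar>f u - f w\<bar>" | "\<bar>f u - f v\<bar> \<le> \<bar>f w - f v\<bar>"
    by (cases "f u \<le> f v"; cases "f v \<le> f w"; cases "f u \<le> f w") auto
  then show "(f u - f v)\<^sup>2 \<le> (r + s) * energy H f"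
  proof cases
    case 1
    show ?thesis by (rule between[where g = f and a = u and b = v and p = r and q = s, OF 1 uw wv r s])
  next
    case 2
    show ?thesis
      using between[where g = f and a = v and b = u and p = s and q = r, OF 2 resistance_le_sym[OF wv] resistance_le_sym[OF uw] s r]
      by (simp only: power2_commute[of "f v"] add.commute[of s])
  next
    case 3
    then have "(f u - f v)\<^sup>2 \<le> (f u - f w)\<^sup>2" by (rule abs_le_square_iff[THEN iffD1])
    then show ?thesis using uw' rs(1) by linarith
  next
    case 4
    then have "(f u - f v)\<^sup>2 \<le> (f w - f v)\<^sup>2" by (rule abs_le_square_iff[THEN iffD1])
    then show ?thesis using wv' rs(2) by linarith
  qed
qed

text \<open>
  Every \<open>z\<close> in \<open>Z\<close> gives a path from \<open>p\<close> to \<open>w\<close> of length at most two, and these paths are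
  edge-disjoint. The set \<open>Z\<close> may contain \<open>w\<close> itself, which stands for the edge from \<open>p\<close> to \<open>w\<close>.
\<close>

text \<open>
  Every \<open>z\<close> in \<open>Z\<close> gives a path from \<open>p\<close> to \<open>w\<close> of length at most two, and these paths are
  edge-disjoint. The set \<open>Z\<close> may contain \<open>w\<close> itself, which stands for the edge from \<open>p\<close> to \<open>w\<close>.
\<close>

lemma resistance_le_common_neighbours:
  assumes H: "pair_graph H" and Z: "Z \<subseteq> neighbours H p \<inter> insert w (neighbours H w)" "Z \<noteq> {}"
  shows "resistance_le H p w (2 / real (card Z))"
  unfolding resistance_le_def
proof
  fix f :: "'a \<Rightarrow> real"
  show "(f p - f w)\<^sup>2 \<le> 2 / real (card Z) * energy H f"
  proof (cases "p = w")
    case False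
    have fin: "finite Z" using Z(1) pair_graph_finite(3)[OF H] finite_subset by blast
    have card: "0 < real (card Z)" using fin Z(2) by (simp add: card_gt_0_iff)
    let ?d = "\<lambda>(x, y). (f x - f y)\<^sup>2"
    define A where "A = Pair p ` Z"
    define B where "B = (\<lambda>z. (z, w)) ` (Z - {w})"
    have A: "sum ?d A = (\<Sum>z\<in>Z. (f p - f z)\<^sup>2)"
      unfolding A_def by (subst sum.reindex) (auto simp: inj_on_def)
    have "sum ?d B = (\<Sum>z\<in>Z - {w}. (f z - f w)\<^sup>2)"
      unfolding B_def by (subst sum.reindex) (auto simp: inj_on_def)
    also have "\<dots> = (\<Sum>z\<in>Z. (f z - f w)\<^sup>2)"
      by (rule sum.mono_neutral_left) (use fin in auto)
    finally have B: "sum ?d B = (\<Sum>z\<in>Z. (f z - f w)\<^sup>2)" .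
    have pZ: "p \<notin> Z" using Z(1) pair_graph_irrefl[OF H] by (auto simp: neighbours_def)
    have "real (card Z) * (f p - f w)\<^sup>2 = (\<Sum>z\<in>Z. (f p - f w)\<^sup>2)" by simp
    also have "\<dots> \<le> (\<Sum>z\<in>Z. 2 * ((f p - f z)\<^sup>2 + (f z - f w)\<^sup>2))"
    proof (rule sum_mono)
      fix z
      have "2 * ((f p - f z)\<^sup>2 + (f z - f w)\<^sup>2) - (f p - f w)\<^sup>2 = ((f p - f z) - (f z - f w))\<^sup>2"
        by (simp add: power2_eq_square algebra_simps)
      moreover have "0 \<le> ((f p - f z) - (f z - f w))\<^sup>2" by simp
      ultimately show "(f p - f w)\<^sup>2 \<le> 2 * ((f p - f z)\<^sup>2 + (f z - f w)\<^sup>2)"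
        by linarith
    qed
    also have "\<dots> = 2 * (sum ?d A + sum ?d B)"
      by (simp add: A B sum.distrib sum_distrib_left)
    also have "sum ?d A + sum ?d B = sum ?d (A \<union> B)"
      using fin pZ by (subst sum.union_disjoint) (auto simp: A_def B_def)
    also have "\<dots> + sum ?d {} / 2 \<le> energy H f"
    proof (rule sum_le_energy[OF H])
      show "A \<union> B \<subseteq> parcs H"
        using Z(1) pair_graph_symD[OF H] by (fastforce simp: A_def B_def neighbours_def)
      show "(A \<union> B) \<inter> (A \<union> B)\<inverse> = {}"
        using pZ False by (auto simp: A_def B_def)
    qed auto
    then have "2 * sum ?d (A \<union> B) \<le> 2 * energy H f" by simp
    finally show ?thesis using card by (simp add: field_simps)
  qed (simp add: energy_nonneg)
qed

text \<open>
  This is the bound given by a unit flow from \<open>p\<close> to \<open>q\<close> that is spread evenly over the walks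
  \<open>p \<rightarrow> z \<rightarrow> w \<rightarrow> q\<close> with \<open>(z, w) \<in> F\<close>: a first edge carries at most \<open>|Q| / |F|\<close>, a last edge at most
  \<open>|P| / |F|\<close>, and a middle edge at most \<open>2 / |F|\<close> because \<open>F\<close> may contain it in both directions.
  No edge serves in two of these roles, as \<open>p\<close> and \<open>q\<close> lie in neither \<open>P\<close> nor \<open>Q\<close>.
\<close>

lemma resistance_le_layers:
  assumes H: "pair_graph H" and P: "P \<subseteq> neighbours H p" "q \<notin> P" and Q: "Q \<subseteq> neighbours H q" "p \<notin> Q"
    and F: "F \<subseteq> P \<times> Q" "\<And>z w. (z, w) \<in> F \<Longrightarrow> z = w \<or> (z, w) \<in> parcs H" "F \<noteq> {}"
    and pq: "p \<noteq> q"
  shows "resistance_le H p q ((real (card P) + real (card Q) + 2) / real (card F))"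
  unfolding resistance_le_def
proof
  fix f :: "'a \<Rightarrow> real"
  let ?d = "\<lambda>(x, y). (f x - f y)\<^sup>2"
  have fin: "finite P" "finite Q" using P(1) Q(1) pair_graph_finite(3)[OF H] finite_subset by blast+
  have finF: "finite F" using F(1) fin finite_subset by blast
  obtain z0 w0 where "(z0, w0) \<in> F" using F(3) by auto
  then have "P \<noteq> {}" "Q \<noteq> {}" using F(1) by auto
  then have pos: "0 < real (card P)" "0 < real (card Q)" "0 < real (card F)"
    using fin finF F(3) by (simp_all add: card_gt_0_iff)
  have pP: "p \<notin> P" and qQ: "q \<notin> Q"
    using P Q pair_graph_irrefl[OF H] by (auto simp: neighbours_def)
  define X where "X = (\<Sum>z\<in>P. (f p - f z)\<^sup>2)"
  define Y where "Y = (\<Sum>(z, w)\<in>F. (f z - f w)\<^sup>2)"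
  define Z where "Z = (\<Sum>w\<in>Q. (f w - f q)\<^sup>2)"
  define O1 where "O1 = Pair p ` P \<union> (\<lambda>w. (w, q)) ` Q"
  have "sum ?d O1 = X + Z"
    unfolding O1_def X_def Z_def using fin pP pq P(2)
    by (subst sum.union_disjoint) (auto simp: sum.reindex inj_on_def)
  moreover have "Y = sum ?d (F - Id)"
    unfolding Y_def by (rule sum.mono_neutral_right) (use finF in auto)
  moreover have "sum ?d O1 + sum ?d (F - Id) / 2 \<le> energy H f"
  proof (rule sum_le_energy[OF H])
    show "O1 \<subseteq> parcs H"
      using P(1) Q(1) pair_graph_symD[OF H] by (fastforce simp: O1_def neighbours_def)
    show "O1 \<inter> O1\<inverse> = {}"
      using P(2) Q(2) pP qQ pq by (auto simp: O1_def)
    show "F - Id \<subseteq> parcs H" using F(2) by auto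
    show "(F - Id) \<inter> O1 = {}" "(F - Id) \<inter> O1\<inverse> = {}"
      using F(1) P(2) Q(2) pP qQ by (auto simp: O1_def)
  qed
  ultimately have E: "X + Y / 2 + Z \<le> energy H f" by simp
  have step: "(a + b + c)\<^sup>2 \<le> (k + l + 2) * (a\<^sup>2 / l + b\<^sup>2 / 2 + c\<^sup>2 / k)" if "0 < k" "0 < l"
    for a b c k l :: real
  proof -
    have "(a + b)\<^sup>2 \<le> (l + 2) * (a\<^sup>2 / l + b\<^sup>2 / 2)"
      by (rule cauchy_two_terms) (use that in auto)
    then have "(a + b + c)\<^sup>2 \<le> (l + 2 + k) * (a\<^sup>2 / l + b\<^sup>2 / 2 + c\<^sup>2 / k)"
      by (rule cauchy_two_terms) (use that in auto)
    then show ?thesis by (simp add: ac_simps)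
  qed
  let ?K = "real (card P) + real (card Q) + 2"
  have divide_le_of_le_mult: "a / c \<le> b" if "a \<le> c * b" "0 < c" for a b c :: real
    using that by (simp add: pos_divide_le_eq mult.commute)
  have first: "(\<Sum>(z, w)\<in>F. (f p - f z)\<^sup>2) \<le> card Q * X"
  proof -
    have "(\<Sum>(z, w)\<in>F. (f p - f z)\<^sup>2) \<le> (\<Sum>(z, w)\<in>P \<times> Q. (f p - f z)\<^sup>2)"
      using fin F(1) by (intro sum_mono2) auto
    also have "\<dots> = card Q * X"
      by (simp add: X_def sum.cartesian_product[symmetric] sum_distrib_left)
    finally show ?thesis .
  qed
  have last: "(\<Sum>(z, w)\<in>F. (f w - f q)\<^sup>2) \<le> card P * Z"
  proof -
    have "(\<Sum>(z, w)\<in>F. (f w - f q)\<^sup>2) \<le> (\<Sum>(z, w)\<in>P \<times> Q. (f w - f q)\<^sup>2)"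
      using fin F(1) by (intro sum_mono2) auto
    also have "\<dots> = card P * Z"
      by (simp add: Z_def sum.cartesian_product[symmetric] sum_distrib_left)
    finally show ?thesis .
  qed
  have "real (card F) * (f p - f q)\<^sup>2 = (\<Sum>e\<in>F. (f p - f q)\<^sup>2)"
    by simp
  also have "\<dots> \<le> (\<Sum>e\<in>F. ?K * ((f p - f (fst e))\<^sup>2 / card Q + (f (fst e) - f (snd e))\<^sup>2 / 2
      + (f (snd e) - f q)\<^sup>2 / card P))"
  proof (rule sum_mono)
    fix e
    show "(f p - f q)\<^sup>2 \<le> ?K * ((f p - f (fst e))\<^sup>2 / card Q + (f (fst e) - f (snd e))\<^sup>2 / 2
        + (f (snd e) - f q)\<^sup>2 / card P)"
      using step[OF pos(1,2), of "f p - f (fst e)" "f (fst e) - f (snd e)" "f (snd e) - f q"]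
      by (simp only: diff_add_cancel add_diff_eq)
  qed
  also have "\<dots> = ?K * ((\<Sum>e\<in>F. (f p - f (fst e))\<^sup>2) / card Q
      + (\<Sum>e\<in>F. (f (fst e) - f (snd e))\<^sup>2) / 2 + (\<Sum>e\<in>F. (f (snd e) - f q)\<^sup>2) / card P)"
    by (simp only: sum_distrib_left[symmetric] sum.distrib sum_divide_distrib[symmetric])
  also have "\<dots> = ?K * ((\<Sum>(z, w)\<in>F. (f p - f z)\<^sup>2) / card Q + Y / 2
      + (\<Sum>(z, w)\<in>F. (f w - f q)\<^sup>2) / card P)"
    by (simp only: Y_def case_prod_unfold)
  also have "\<dots> \<le> ?K * (X + Y / 2 + Z)"
    using first last pos
    by (intro mult_left_mono add_mono order_refl divide_le_of_le_mult) simp_all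
  also have "\<dots> \<le> ?K * energy H f"
    using E by (intro mult_left_mono) auto
  finally show "(f p - f q)\<^sup>2 \<le> ?K / real (card F) * energy H f"
    using pos(3) by (simp add: pos_le_divide_eq mult.commute)
qed

section \<open>Resistances in a graph and in its complement\<close>

lemma neighbours_complement_graph:
  assumes "pair_graph H" "v \<in> pverts H"
  shows "neighbours (complement_graph H) v = pverts H - insert v (neighbours H v)"
  using assms(2) by (auto simp: neighbours_def complement_graph_def)

lemma pverts_complement_graph [simp]: "pverts (complement_graph H) = pverts H"
  by (simp add: complement_graph_def)

lemma complement_complement_graph:
  assumes "pair_graph H"
  shows "complement_graph (complement_graph H) = H"
proof -
  have "parcs (complement_graph (complement_graph H)) = parcs H"
    using pair_graph_arc_verts[OF assms] pair_graph_irrefl[OF assms]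
    by (auto simp: complement_graph_def)
  then show ?thesis by (simp add: complement_graph_def)
qed

text \<open>Two subsets of \<open>U\<close> with more than \<open>4 / 5\<close> of its elements share more than \<open>3 / 5\<close> of them.\<close>

lemma resistance_le_many_common_neighbours:
  assumes H: "pair_graph H" and U: "finite U"
    and i: "4 * card U < 5 * card (neighbours H i \<inter> U)" and j: "4 * card U < 5 * card (neighbours H j \<inter> U)"
  shows "resistance_le H i j (4 * (1 / real (card U)))"
proof -
  define Z where "Z = neighbours H i \<inter> neighbours H j \<inter> U"
  have "card (neighbours H i \<inter> U) + card (neighbours H j \<inter> U)
      = card ((neighbours H i \<inter> U) \<union> (neighbours H j \<inter> U)) + card ((neighbours H i \<inter> U) \<inter> (neighbours H j \<inter> U))"
    using U by (intro card_Un_Int) auto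
  also have "(neighbours H i \<inter> U) \<inter> (neighbours H j \<inter> U) = Z" by (auto simp: Z_def)
  also have "card ((neighbours H i \<inter> U) \<union> (neighbours H j \<inter> U)) \<le> card U"
    using U by (intro card_mono) auto
  finally have Z: "3 * card U < 5 * card Z" using i j by linarith
  have "card (neighbours H i \<inter> U) \<le> card U" using U by (intro card_mono) auto
  then have Upos: "0 < card U" using i by linarith
  have "Z \<noteq> {}" using Z by auto
  then have "resistance_le H i j (2 / real (card Z))"
    by (intro resistance_le_common_neighbours[OF H]) (auto simp: Z_def)
  moreover have "2 / real (card Z) \<le> 4 * (1 / real (card U))"
    using Z Upos by (simp add: divide_simps)
  ultimately show ?thesis by (rule resistance_le_mono)
qed

text \<open>
  A pair that is badly connected in the complement forces every pair to be well connected in \<open>H\<close>. The bound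
  is uniform: it depends on \<open>x\<close> and \<open>y\<close> and not on the degrees of \<open>i\<close> and \<open>j\<close>, which is what makes the two
  directions comparable later.
\<close>

lemma resistance_le_of_complement:
  assumes H: "pair_graph H" and x: "x \<in> pverts H" and y: "y \<in> pverts H"
    and S: "S = neighbours (complement_graph H) x" "S \<noteq> {}"
    and T: "T = neighbours (complement_graph H) y" "T \<noteq> {}"
    and bad: "\<not> resistance_le (complement_graph H) x y (10 * (1 / real (card S) + 1 / real (card T)))"
    and i: "i \<in> pverts H" and j: "j \<in> pverts H"
  shows "resistance_le H i j (10 * (1 / real (card S) + 1 / real (card T)))"
proof -
  let ?C = "complement_graph H"
  have C: "pair_graph ?C" by (rule pair_graph_complement_graph[OF H])
  have fin: "finite S" "finite T" using S(1) T(1) pair_graph_finite(3)[OF C] by auto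
  define s where "s = real (card S)"
  define t where "t = real (card T)"
  have s: "0 < s" "1 \<le> s" and t: "0 < t" "1 \<le> t"
    using fin S(2) T(2) by (simp_all add: s_def t_def card_gt_0_iff Suc_le_eq)
  have SV: "S \<subseteq> pverts H" and TV: "T \<subseteq> pverts H"
    using S(1) T(1) neighbours_complement_graph[OF H] x y by auto
  have xS: "x \<notin> S" and yT: "y \<notin> T"
    using S(1) T(1) neighbours_complement_graph[OF H] x y by auto
  have xy: "x \<noteq> y" using bad s t resistance_le_refl[of "10 * (1 / s + 1 / t)" ?C x]
    by (auto simp: s_def t_def)
  have nbrs: "neighbours H w \<inter> U = U - insert w (neighbours ?C w)"
    if "w \<in> pverts H" "U \<subseteq> pverts H" for w U
    using that neighbours_complement_graph[OF H that(1)] pair_graph_arc_verts(2)[OF H]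
      pair_graph_irrefl[OF H] by (auto simp: neighbours_def)
  \<comment> \<open>The closed neighbourhood is needed on the right, since \<open>w\<close> may itself lie in \<open>U\<close> without being
    its own neighbour in \<open>H\<close>.\<close>
  have near_iff: "4 * card U < 5 * card (neighbours H w \<inter> U) \<longleftrightarrow> 5 * card (U \<inter> insert w (neighbours ?C w)) < card U"
    if "w \<in> pverts H" "U \<subseteq> pverts H" "finite U" for w U
  proof -
    have "card (neighbours H w \<inter> U) + card (U \<inter> insert w (neighbours ?C w)) = card U"
      using that(3) nbrs[OF that(1,2)]
      by (metis add.commute card_Int_Diff)
    then show ?thesis by linarith
  qed
  \<comment> \<open>Otherwise \<open>w\<close> joins \<open>x\<close> to \<open>y\<close> in the complement with resistance at most \<open>10 / s + 10 / t\<close>.\<close>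
  have near: "4 * card S < 5 * card (neighbours H w \<inter> S) \<or> 4 * card T < 5 * card (neighbours H w \<inter> T)"
    if w: "w \<in> pverts H" for w
  proof (rule ccontr)
    assume "\<not> ?thesis"
    then have SZ: "card S \<le> 5 * card (S \<inter> insert w (neighbours ?C w))"
      and TZ: "card T \<le> 5 * card (T \<inter> insert w (neighbours ?C w))"
      using near_iff[OF w SV fin(1)] near_iff[OF w TV fin(2)] by auto
    have part: "resistance_le ?C z w (10 * (1 / real (card U)))"
      if U: "U = neighbours ?C z" "0 < card U" and UZ: "card U \<le> 5 * card (U \<inter> insert w (neighbours ?C w))"
      for z U
    proof -
      have "U \<inter> insert w (neighbours ?C w) \<noteq> {}" using U(2) UZ by (metis card.empty mult_0_right not_less)
      then have "resistance_le ?C z w (2 / real (card (U \<inter> insert w (neighbours ?C w))))"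
        by (intro resistance_le_common_neighbours[OF C]) (auto simp: U(1))
      moreover have "2 / real (card (U \<inter> insert w (neighbours ?C w))) \<le> 10 * (1 / real (card U))"
      proof -
        have "0 < card (U \<inter> insert w (neighbours ?C w))" using U(2) UZ by linarith
        then show ?thesis using U(2) UZ by (simp add: divide_simps)
      qed
      ultimately show ?thesis by (rule resistance_le_mono)
    qed
    have "resistance_le ?C x w (10 * (1 / s))" "resistance_le ?C y w (10 * (1 / t))"
      using part[OF S(1) _ SZ] part[OF T(1) _ TZ] s(1) t(1) by (simp_all add: s_def t_def)
    then have "resistance_le ?C x y (10 * (1 / s) + 10 * (1 / t))"
      using s t by (intro resistance_le_trans[of _ _ w] resistance_le_sym[of _ y]) auto
    then show False using bad by (simp add: s_def t_def distrib_left)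
  qed
  have near_yS: "4 * card S < 5 * card (neighbours H y \<inter> S)"
  proof -
    have "neighbours H y \<inter> T = {}" using nbrs[OF y TV] T(1) by auto
    then show ?thesis using near[OF y] by auto
  qed
  have near_xT: "4 * card T < 5 * card (neighbours H x \<inter> T)"
  proof -
    have "neighbours H x \<inter> S = {}" using nbrs[OF x SV] S(1) by auto
    then show ?thesis using near[OF x] by auto
  qed
  have yx: "resistance_le H y x (5 * (1 / s + 1 / t))"
  proof -
    define P where "P = neighbours H y \<inter> S"
    define Q where "Q = neighbours H x \<inter> T"
    \<comment> \<open>\<open>F0\<close> collects the pairs that carry a walk from \<open>x\<close> to \<open>y\<close> in the complement, so badness bounds its
      size. Removing \<open>y\<close> and \<open>x\<close> keeps an edge \<open>xy\<close> of the complement from being used as a first and as a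
      last edge; pairs in \<open>P \<times> Q\<close> avoid them anyway.\<close>
    define F0 where "F0 = {(z, w). z \<in> S - {y} \<and> w \<in> T - {x} \<and> (z = w \<or> (z, w) \<in> parcs ?C)}"
    define F where "F = P \<times> Q - F0"
    have F0_sub: "F0 \<subseteq> (S - {y}) \<times> (T - {x})" by (auto simp: F0_def)
    have finF0: "finite F0" using finite_subset[OF F0_sub] fin by simp
    have F0: "5 * real (card F0) \<le> s * t"
    proof (cases "F0 = {}")
      case False
      then have F0pos: "0 < real (card F0)" using finF0 by (simp add: card_gt_0_iff)
      have "resistance_le ?C x y ((real (card (S - {y})) + real (card (T - {x})) + 2) / real (card F0))"
        using F0_sub False xy S(1) T(1) xS yT
        by (intro resistance_le_layers[OF C]) (auto simp: F0_def)
      then have "10 * (1 / s + 1 / t) < (real (card (S - {y})) + real (card (T - {x})) + 2) / real (card F0)"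
        using bad resistance_le_mono unfolding s_def t_def by (meson not_le)
      also have "\<dots> \<le> (s + t + 2) / real (card F0)"
        using F0pos fin by (intro divide_right_mono add_mono) (auto simp: s_def t_def intro!: card_mono)
      also have "\<dots> \<le> 2 * (s + t) / real (card F0)"
        using F0pos s t by (intro divide_right_mono) auto
      finally have "10 * ((s + t) / (s * t)) < 2 * (s + t) / real (card F0)"
        using s t by (simp add: add_divide_eq_iff divide_add_eq_iff add.commute)
      then have "(s + t) * (10 / (s * t)) < (s + t) * (2 / real (card F0))"
        by (simp only: times_divide_eq_right mult.commute)
      then have "10 / (s * t) < 2 / real (card F0)"
        by (rule mult_left_less_imp_less) (use s t in simp)
      then show ?thesis using s t F0pos by (simp add: divide_simps mult.commute)
    qed (use s t in simp)
    have finPQ: "finite P" "finite Q" using fin by (auto simp: P_def Q_def)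
    have P: "4 / 5 * s \<le> real (card P)" "real (card P) \<le> s"
      using near_yS fin by (auto simp: P_def s_def intro!: card_mono)
    have Q: "4 / 5 * t \<le> real (card Q)" "real (card Q) \<le> t"
      using near_xT fin by (auto simp: Q_def t_def intro!: card_mono)
    have "(4 / 5 * s) * (4 / 5 * t) \<le> real (card P) * real (card Q)"
      using P(1) Q(1) s t by (intro mult_mono) auto
    also have "\<dots> = real (card (P \<times> Q))" by (simp add: card_cartesian_product)
    also have "\<dots> \<le> real (card F) + real (card F0)"
    proof -
      have "card (P \<times> Q) \<le> card (F \<union> F0)" using finPQ finF0 by (intro card_mono) (auto simp: F_def)
      also have "\<dots> \<le> card F + card F0" by (rule card_Un_le)
      finally show ?thesis by linarith
    qed
    finally have F: "2 / 5 * (s * t) \<le> real (card F)" using F0 s t by simp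
    moreover have "0 < 2 / 5 * (s * t)" using s t by simp
    ultimately have Fpos: "0 < real (card F)" by linarith
    have arcs: "z = w \<or> (z, w) \<in> parcs H" if "(z, w) \<in> F" for z w
      using that SV TV pair_graph_irrefl[OF H]
      by (auto simp: F_def F0_def P_def Q_def neighbours_def complement_graph_def)
    have "resistance_le H y x ((real (card P) + real (card Q) + 2) / real (card F))"
    proof (rule resistance_le_layers[OF H _ _ _ _ _ arcs])
      show "F \<noteq> {}" using Fpos by auto
    qed (use xy xS yT in \<open>auto simp: P_def Q_def F_def\<close>)
    moreover have "(real (card P) + real (card Q) + 2) / real (card F) \<le> 5 * (1 / s + 1 / t)"
    proof -
      have "(real (card P) + real (card Q) + 2) / real (card F) \<le> (2 * (s + t)) / (2 / 5 * (s * t))"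
        using P(2) Q(2) F s t by (intro frac_le) auto
      also have "\<dots> = 5 * (1 / s + 1 / t)" using s t by (simp add: field_simps)
      finally show ?thesis .
    qed
    ultimately show ?thesis by (rule resistance_le_mono)
  qed
  have same: "resistance_le H a b (4 * (1 / s))"
    if "4 * card S < 5 * card (neighbours H a \<inter> S)" "4 * card S < 5 * card (neighbours H b \<inter> S)" for a b
    using resistance_le_many_common_neighbours[OF H fin(1) that] by (simp add: s_def)
  have same': "resistance_le H a b (4 * (1 / t))"
    if "4 * card T < 5 * card (neighbours H a \<inter> T)" "4 * card T < 5 * card (neighbours H b \<inter> T)" for a b
    using resistance_le_many_common_neighbours[OF H fin(2) that] by (simp add: t_def)
  have st: "0 < 1 / s" "0 < 1 / t" using s t by auto
  \<comment> \<open>The route is \<open>a\<close>, \<open>y\<close>, \<open>x\<close>, \<open>b\<close>: in \<open>H\<close> the vertex \<open>y\<close> has no neighbour in \<open>T\<close>, hence it is close to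
    \<open>S\<close>, and symmetrically \<open>x\<close> is close to \<open>T\<close>.\<close>
  have cross: "resistance_le H a b (10 * (1 / s + 1 / t))"
    if a: "4 * card S < 5 * card (neighbours H a \<inter> S)" and b: "4 * card T < 5 * card (neighbours H b \<inter> T)" for a b
  proof -
    have "resistance_le H a x (4 * (1 / s) + 5 * (1 / s + 1 / t))"
      using st by (intro resistance_le_trans[OF same[OF a near_yS] yx]) auto
    then have ab: "resistance_le H a b (4 * (1 / s) + 5 * (1 / s + 1 / t) + 4 * (1 / t))"
      using st by (intro resistance_le_trans[OF _ same'[OF near_xT b]]) auto
    have "4 * p + 5 * (p + q) + 4 * q \<le> 10 * (p + q)" if "0 < p" "0 < q" for p q :: real
      using that by simp
    from resistance_le_mono[OF ab this[OF st]] show ?thesis .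
  qed
  have "4 * p \<le> 10 * (p + q)" "4 * q \<le> 10 * (p + q)" if "0 < p" "0 < q" for p q :: real
    using that by simp_all
  from this[OF st] have le: "4 * (1 / s) \<le> 10 * (1 / s + 1 / t)" "4 * (1 / t) \<le> 10 * (1 / s + 1 / t)" .
  consider "4 * card S < 5 * card (neighbours H i \<inter> S)" "4 * card S < 5 * card (neighbours H j \<inter> S)"
    | "4 * card T < 5 * card (neighbours H i \<inter> T)" "4 * card T < 5 * card (neighbours H j \<inter> T)"
    | "4 * card S < 5 * card (neighbours H i \<inter> S)" "4 * card T < 5 * card (neighbours H j \<inter> T)"
    | "4 * card T < 5 * card (neighbours H i \<inter> T)" "4 * card S < 5 * card (neighbours H j \<inter> S)"
    using near[OF i] near[OF j] by linarith
  then have "resistance_le H i j (10 * (1 / s + 1 / t))"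
  proof cases
    case 1
    then show ?thesis by (rule resistance_le_mono[OF same le(1)])
  next
    case 2
    then show ?thesis by (rule resistance_le_mono[OF same' le(2)])
  next
    case 3
    then show ?thesis by (rule cross)
  next
    case 4
    then show ?thesis by (intro resistance_le_sym[OF cross])
  qed
  then show ?thesis by (simp add: s_def t_def)
qed

text \<open>
  Isolated vertices are excluded because a degree \<open>0\<close> would contribute \<open>1 / 0 = 0\<close> instead of an
  infinite bound.
\<close>

definition degree_bounded_resistances :: "'a pair_pre_digraph \<Rightarrow> bool" where
  "degree_bounded_resistances H \<longleftrightarrow>
     (\<forall>v\<in>pverts H. neighbours H v \<noteq> {}) \<and>
     (\<forall>u\<in>pverts H. \<forall>v\<in>pverts H.
        resistance_le H u v (10 * (1 / real (vertex_degree H u) + 1 / real (vertex_degree H v))))"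

lemma degree_bounded_resistances_universal_vertex:
  assumes H: "pair_graph H" and n: "2 \<le> card (pverts H)"
    and x: "x \<in> pverts H" and isolated: "neighbours (complement_graph H) x = {}"
  shows "degree_bounded_resistances H"
proof -
  have x_adj: "(x, v) \<in> parcs H" "(v, x) \<in> parcs H" if "v \<in> pverts H" "v \<noteq> x" for v
    using isolated that neighbours_complement_graph[OF H x] pair_graph_symD[OF H, of x v]
    by (auto simp: neighbours_def)
  have nonempty: "neighbours H v \<noteq> {}" if v: "v \<in> pverts H" for v
  proof (cases "v = x")
    case True
    obtain u where "u \<in> pverts H" "u \<noteq> x"
      using n x by (metis card_le_Suc0_iff_eq not_less_eq_eq numeral_2_eq_2 pair_graph_finite(1)[OF H])
    then show ?thesis using x_adj(1)[of u] True by (auto simp: neighbours_def)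
  next
    case False
    then show ?thesis using x_adj(2)[of v] v by (auto simp: neighbours_def)
  qed
  have to_x: "resistance_le H v x (2 / real (vertex_degree H v))" if v: "v \<in> pverts H" for v
  proof (cases "v = x")
    case False
    have "neighbours H v \<subseteq> insert x (neighbours H x)"
      using x_adj(1) pair_graph_arc_verts(2)[OF H] by (auto simp: neighbours_def)
    then show ?thesis
      using nonempty[OF v]
      by (auto simp: vertex_degree_eq_card_neighbours intro!: resistance_le_common_neighbours[OF H])
  qed (simp add: resistance_le_refl)
  have "resistance_le H u v (10 * (1 / real (vertex_degree H u) + 1 / real (vertex_degree H v)))"
    if "u \<in> pverts H" "v \<in> pverts H" for u v
  proof (rule resistance_le_mono)
    show "resistance_le H u v (2 / real (vertex_degree H u) + 2 / real (vertex_degree H v))"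
      using that by (intro resistance_le_trans[OF to_x resistance_le_sym[OF to_x]]) auto
    show "2 / real (vertex_degree H u) + 2 / real (vertex_degree H v)
        \<le> 10 * (1 / real (vertex_degree H u) + 1 / real (vertex_degree H v))"
      unfolding distrib_left by (intro add_mono) (simp_all add: divide_right_mono)
  qed
  then show ?thesis using nonempty by (simp add: degree_bounded_resistances_def)
qed

text \<open>
  If both graphs had a violating pair, each violation would bound all resistances in the other graph, and
  the smaller of the two bounds would contradict one of the violations.
\<close>

lemma degree_bounded_resistances_or_complement:
  assumes G: "pair_graph G" and n: "2 \<le> card (pverts G)"
  shows "degree_bounded_resistances G \<or> degree_bounded_resistances (complement_graph G)"
proof (cases "\<exists>x\<in>pverts G. neighbours G x = {} \<or> neighbours (complement_graph G) x = {}")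
  case True
  then show ?thesis
    using degree_bounded_resistances_universal_vertex[OF G n]
      degree_bounded_resistances_universal_vertex[OF pair_graph_complement_graph[OF G]] n
    by (auto simp: complement_complement_graph[OF G])
next
  case False
  let ?C = "complement_graph G"
  let ?b = "\<lambda>H u v. 10 * (1 / real (vertex_degree H u) + 1 / real (vertex_degree H v))"
  have C: "pair_graph ?C" by (rule pair_graph_complement_graph[OF G])
  have key: "resistance_le H u v (?b (complement_graph H) x y)"
    if "pair_graph H" "x \<in> pverts H" "y \<in> pverts H" "u \<in> pverts H" "v \<in> pverts H"
      "neighbours (complement_graph H) x \<noteq> {}" "neighbours (complement_graph H) y \<noteq> {}"
      "\<not> resistance_le (complement_graph H) x y (?b (complement_graph H) x y)" for H x y u v
    using resistance_le_of_complement[OF that(1-3) refl that(6) refl that(7) _ that(4,5)] that(8)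
    by (simp add: vertex_degree_eq_card_neighbours)
  show ?thesis
  proof (rule ccontr)
    assume "\<not> ?thesis"
    then obtain u v x y where uv: "u \<in> pverts G" "v \<in> pverts G" "\<not> resistance_le G u v (?b G u v)"
      and xy: "x \<in> pverts G" "y \<in> pverts G" "\<not> resistance_le ?C x y (?b ?C x y)"
      using False unfolding degree_bounded_resistances_def by auto
    have "resistance_le G u v (?b ?C x y)"
      using key[OF G xy(1,2) uv(1,2)] xy False by blast
    moreover have "resistance_le ?C x y (?b G u v)"
      using key[OF C, of u v x y] uv xy(1,2) False by (simp add: complement_complement_graph[OF G])
    ultimately show False
      using uv(3) xy(3) resistance_le_mono by (meson linear)
  qed
qed

section \<open>The Laplacian\<close>

definition laplacian :: "'a pair_pre_digraph \<Rightarrow> ('a \<Rightarrow> real) \<Rightarrow> 'a \<Rightarrow> real" where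
  "laplacian H f x = (\<Sum>y\<in>neighbours H x. f x - f y)"

lemma parcs_eq_Sigma: "pair_graph H \<Longrightarrow> parcs H = Sigma (pverts H) (neighbours H)"
  by (auto simp: neighbours_def dest: pair_graph_arc_verts)

lemma sum_parcs:
  assumes "pair_graph H"
  shows "(\<Sum>(x, y)\<in>parcs H. g x y) = (\<Sum>x\<in>pverts H. \<Sum>y\<in>neighbours H x. g x y)"
  unfolding parcs_eq_Sigma[OF assms]
  by (subst sum.Sigma) (auto simp: pair_graph_finite[OF assms])

lemma sum_parcs_swap:
  assumes "pair_graph H"
  shows "(\<Sum>(x, y)\<in>parcs H. g x y) = (\<Sum>(x, y)\<in>parcs H. g y x)"
  by (rule sum.reindex_bij_witness[where i = prod.swap and j = prod.swap])
    (use pair_graph_symD[OF assms] in auto)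

lemma card_parcs_eq_sum_degree:
  assumes "pair_graph H"
  shows "card (parcs H) = (\<Sum>v\<in>pverts H. vertex_degree H v)"
  unfolding parcs_eq_Sigma[OF assms] vertex_degree_eq_card_neighbours
  by (rule card_SigmaI) (auto simp: pair_graph_finite[OF assms])

lemma laplacian_eq:
  assumes "pair_graph H"
  shows "laplacian H f x = real (vertex_degree H x) * f x - (\<Sum>y\<in>neighbours H x. f y)"
  by (simp add: laplacian_def sum_subtractf vertex_degree_eq_card_neighbours)

lemma laplacian_diff: "laplacian H (\<lambda>x. f x - g x) x = laplacian H f x - laplacian H g x"
  by (simp add: laplacian_def sum_subtractf[symmetric] algebra_simps)

text \<open>Summation by parts.\<close>

lemma energy_eq_sum_laplacian:
  assumes H: "pair_graph H"
  shows "energy H f = (\<Sum>x\<in>pverts H. f x * laplacian H f x)"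
proof -
  have "(\<Sum>(x, y)\<in>parcs H. (f x - f y)\<^sup>2) = (\<Sum>(x, y)\<in>parcs H. f x * (f x - f y) + f y * (f y - f x))"
    by (rule sum.cong) (auto simp: power2_eq_square algebra_simps)
  also have "\<dots> = (\<Sum>(x, y)\<in>parcs H. f x * (f x - f y)) + (\<Sum>(x, y)\<in>parcs H. f y * (f y - f x))"
    by (simp only: case_prod_unfold sum.distrib)
  also have "(\<Sum>(x, y)\<in>parcs H. f y * (f y - f x)) = (\<Sum>(x, y)\<in>parcs H. f x * (f x - f y))"
    by (rule sum_parcs_swap[OF H])
  also have "(\<Sum>(x, y)\<in>parcs H. f x * (f x - f y)) = (\<Sum>x\<in>pverts H. f x * laplacian H f x)"
    by (simp only: sum_parcs[OF H] laplacian_def sum_distrib_left)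
  finally show ?thesis by (simp add: energy_def)
qed

lemma sum_laplacian:
  assumes H: "pair_graph H"
  shows "(\<Sum>x\<in>pverts H. laplacian H f x) = 0"
proof -
  have "(\<Sum>x\<in>pverts H. laplacian H f x) = (\<Sum>(x, y)\<in>parcs H. f x) - (\<Sum>(x, y)\<in>parcs H. f y)"
    by (simp add: sum_parcs[OF H] laplacian_def sum_subtractf)
  then show ?thesis using sum_parcs_swap[OF H, of "\<lambda>x y. f x"] by simp
qed

section \<open>Hitting times\<close>

lemma hitting_time_self: "hitting_time j j \<omega> = 0"
proof -
  have "hitting_time j j \<omega> \<le> of_nat 0"
    unfolding hitting_time_def by (rule INF_lower) simp
  then show ?thesis by simp
qed

lemma hitting_time_Stream:
  assumes "i \<noteq> j"
  shows "hitting_time i j (f ## \<omega>) = 1 + hitting_time (f i) j \<omega>"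
proof -
  let ?T = "{t. walk (f i) \<omega> t = j}"
  have "walk i (f ## \<omega>) (Suc t) = walk (f i) \<omega> t" for t
    by (induction t) auto
  then have eq: "{t. walk i (f ## \<omega>) t = j} = Suc ` ?T"
    using assms by (auto simp: image_iff simp del: walk.simps(2)) (metis not0_implies_Suc walk.simps(1))
  show ?thesis
  proof (cases "?T = {}")
    case True
    then show ?thesis by (simp only: hitting_time_def eq) simp
  next
    case False
    define m where "m = (LEAST t. t \<in> ?T)"
    have m: "m \<in> ?T" "m \<le> t" if "t \<in> ?T" for t
      unfolding m_def using that by (rule LeastI, rule Least_le)
    have attained: "(INF t\<in>?T. c + of_nat t) = c + (of_nat m :: ennreal)" for c
    proof (rule antisym)
      show "(INF t\<in>?T. c + of_nat t) \<le> c + (of_nat m :: ennreal)"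
        using False m(1) by (intro INF_lower) blast
      show "c + (of_nat m :: ennreal) \<le> (INF t\<in>?T. c + of_nat t)"
        using m(2) by (intro INF_greatest add_left_mono of_nat_mono)
    qed
    have "hitting_time i j (f ## \<omega>) = (INF t\<in>?T. 1 + of_nat t)"
      unfolding hitting_time_def eq image_image of_nat_Suc ..
    then show ?thesis
      using attained[of 1] attained[of 0] by (simp add: hitting_time_def)
  qed
qed

text \<open>
  The cap \<open>c\<close> serves two purposes: with \<open>c\<close> a natural number the expectation is finite before anything is
  known about the walk, and \<open>c = \<infinity>\<close> gives the expected hitting time, so that one first-step equation
  covers both.
\<close>

definition capped_hitting_time :: "'a pair_pre_digraph \<Rightarrow> ennreal \<Rightarrow> 'a \<Rightarrow> 'a \<Rightarrow> ennreal" where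
  "capped_hitting_time H c i j = (\<integral>\<^sup>+ \<omega>. min (hitting_time i j \<omega>) c \<partial>walk_space H)"

lemma capped_hitting_time_self: "capped_hitting_time H c j j = 0"
  by (simp add: capped_hitting_time_def hitting_time_self)

lemma uncapped_hitting_time: "capped_hitting_time H top i j = expected_hitting_time H i j"
  by (simp add: capped_hitting_time_def expected_hitting_time_def)

lemma capped_hitting_time_mono: "c \<le> c' \<Longrightarrow> capped_hitting_time H c i j \<le> capped_hitting_time H c' i j"
  unfolding capped_hitting_time_def by (intro nn_integral_mono min.mono order_refl)

context
  fixes H :: "'a pair_pre_digraph"
  assumes H: "pair_graph H" and no_isolated: "\<And>v. v \<in> pverts H \<Longrightarrow> neighbours H v \<noteq> {}"
begin

lemma borel_hitting_time: "i \<in> pverts H \<Longrightarrow> hitting_time i j \<in> borel_measurable (walk_space H)"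
  by (rule measurable_hitting_time[OF H no_isolated])

lemma vertex_degree_pos: "v \<in> pverts H \<Longrightarrow> 1 \<le> real (vertex_degree H v)"
  using no_isolated[of v] pair_graph_finite(3)[OF H, of v]
  by (simp add: vertex_degree_eq_card_neighbours Suc_le_eq card_gt_0_iff)

lemma neighbours_verts: "w \<in> neighbours H u \<Longrightarrow> w \<in> pverts H"
  using pair_graph_arc_verts(2)[OF H] by (auto simp: neighbours_def)

lemma nn_integral_step_space:
  assumes u: "u \<in> pverts H"
  shows "(\<integral>\<^sup>+ f. \<phi> (f u) \<partial>step_space H)
    = (\<Sum>w\<in>neighbours H u. \<phi> w * ennreal (1 / real (vertex_degree H u)))"
proof -
  interpret prob_space "step_space H" by (rule prob_space_step_space[OF H no_isolated])
  note space = space_step_space[OF H no_isolated]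
  let ?B = "\<lambda>w. {f \<in> space (step_space H). f u = w}"
  have B: "?B w \<in> sets (step_space H)" for w
    by (auto simp: sets_step_space[OF H no_isolated] space)
  have fin: "finite (neighbours H u)" by (rule pair_graph_finite[OF H])
  have "(\<integral>\<^sup>+ f. \<phi> (f u) \<partial>step_space H)
      = (\<integral>\<^sup>+ f. (\<Sum>w\<in>neighbours H u. \<phi> w * indicator (?B w) f) \<partial>step_space H)"
  proof (rule nn_integral_cong)
    fix f assume f: "f \<in> space (step_space H)"
    then have fu: "f u \<in> neighbours H u" using u by (auto simp: space PiE_iff)
    have "(\<Sum>w\<in>neighbours H u. \<phi> w * indicator (?B w) f) = (\<Sum>w\<in>neighbours H u. if w = f u then \<phi> w else 0)"
      using f by (intro sum.cong) (auto simp: indicator_def)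
    also have "\<dots> = \<phi> (f u)" using fu fin by simp
    finally show "\<phi> (f u) = (\<Sum>w\<in>neighbours H u. \<phi> w * indicator (?B w) f)" ..
  qed
  also have "\<dots> = (\<Sum>w\<in>neighbours H u. \<integral>\<^sup>+ f. \<phi> w * indicator (?B w) f \<partial>step_space H)"
    using B by (intro nn_integral_sum) simp
  also have "\<dots> = (\<Sum>w\<in>neighbours H u. \<phi> w * ennreal (1 / real (vertex_degree H u)))"
  proof (rule sum.cong)
    fix w assume w: "w \<in> neighbours H u"
    have "(\<integral>\<^sup>+ f. \<phi> w * indicator (?B w) f \<partial>step_space H) = \<phi> w * emeasure (step_space H) (?B w)"
      using B by (rule nn_integral_cmult_indicator)
    also have "emeasure (step_space H) (?B w) = ennreal (1 / real (vertex_degree H u))"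
      using w by (simp add: emeasure_eq_measure prob_step[OF H no_isolated u] neighbours_def)
    finally show "(\<integral>\<^sup>+ f. \<phi> w * indicator (?B w) f \<partial>step_space H) = \<phi> w * ennreal (1 / real (vertex_degree H u))" .
  qed simp
  finally show ?thesis .
qed

lemma capped_hitting_time_first_step:
  assumes i: "i \<in> pverts H" and ij: "i \<noteq> j"
  shows "capped_hitting_time H (1 + c) i j
    = 1 + (\<Sum>w\<in>neighbours H i. capped_hitting_time H c w j * ennreal (1 / real (vertex_degree H i)))"
proof -
  interpret S: prob_space "step_space H" by (rule prob_space_step_space[OF H no_isolated])
  interpret W: prob_space "walk_space H" by (rule prob_space_walk_space[OF H no_isolated])
  have "(\<lambda>\<omega>. min (hitting_time i j \<omega>) (1 + c)) \<in> borel_measurable (walk_space H)"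
    using borel_hitting_time[OF i] by measurable
  then have "capped_hitting_time H (1 + c) i j
      = (\<integral>\<^sup>+ f. \<integral>\<^sup>+ \<omega>. min (hitting_time i j (f ## \<omega>)) (1 + c) \<partial>walk_space H \<partial>step_space H)"
    unfolding capped_hitting_time_def walk_space_def by (rule S.nn_integral_stream_space)
  also have "\<dots> = (\<integral>\<^sup>+ f. 1 + capped_hitting_time H c (f i) j \<partial>step_space H)"
  proof (rule nn_integral_cong)
    fix f assume "f \<in> space (step_space H)"
    then have "f i \<in> pverts H"
      using i neighbours_verts by (auto simp: space_step_space[OF H no_isolated] PiE_iff)
    then have [measurable]: "hitting_time (f i) j \<in> borel_measurable (walk_space H)"
      by (rule borel_hitting_time)
    have "min (1 + a) (1 + c) = 1 + min a c" for a :: ennreal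
      by (rule min_of_mono) (auto simp: mono_def intro: add_left_mono)
    then show "(\<integral>\<^sup>+ \<omega>. min (hitting_time i j (f ## \<omega>)) (1 + c) \<partial>walk_space H) = 1 + capped_hitting_time H c (f i) j"
      by (simp add: hitting_time_Stream[OF ij] capped_hitting_time_def nn_integral_add W.emeasure_space_1)
  qed
  also have "\<dots> = 1 + (\<integral>\<^sup>+ f. capped_hitting_time H c (f i) j \<partial>step_space H)"
  proof (subst nn_integral_add)
    show "(\<lambda>f. capped_hitting_time H c (f i) j) \<in> borel_measurable (step_space H)"
      by (auto simp: measurable_def sets_step_space[OF H no_isolated] space_step_space[OF H no_isolated])
  qed (simp_all add: S.emeasure_space_1)
  also have "\<dots> = 1 + (\<Sum>w\<in>neighbours H i. capped_hitting_time H c w j * ennreal (1 / real (vertex_degree H i)))"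
    by (simp add: nn_integral_step_space[OF i, where \<phi> = "\<lambda>w. capped_hitting_time H c w j"])
  finally show ?thesis .
qed

lemma capped_hitting_time_first_step_real:
  assumes i: "i \<in> pverts H" and ij: "i \<noteq> j" and a: "capped_hitting_time H (1 + c) i j = ennreal a" "0 \<le> a"
    and b: "\<And>w. w \<in> pverts H \<Longrightarrow> capped_hitting_time H c w j = ennreal (b w)" "\<And>w. 0 \<le> b w"
  shows "real (vertex_degree H i) * a = real (vertex_degree H i) + (\<Sum>w\<in>neighbours H i. b w)"
proof -
  let ?d = "real (vertex_degree H i)"
  have d: "0 < ?d" using vertex_degree_pos[OF i] by linarith
  have "ennreal a = 1 + (\<Sum>w\<in>neighbours H i. capped_hitting_time H c w j * ennreal (1 / ?d))"
    using capped_hitting_time_first_step[OF i ij] a(1) by simp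
  also have "(\<Sum>w\<in>neighbours H i. capped_hitting_time H c w j * ennreal (1 / ?d)) = (\<Sum>w\<in>neighbours H i. ennreal (b w / ?d))"
    using b neighbours_verts d by (intro sum.cong) (auto simp: ennreal_mult'[symmetric])
  also have "\<dots> = ennreal ((\<Sum>w\<in>neighbours H i. b w) / ?d)"
    using b(2) d by (subst sum_ennreal) (auto simp: sum_divide_distrib)
  also have "1 + \<dots> = ennreal (1 + (\<Sum>w\<in>neighbours H i. b w) / ?d)"
    using b(2) d by (subst ennreal_plus) (auto intro!: divide_nonneg_nonneg sum_nonneg)
  finally have "a = 1 + (\<Sum>w\<in>neighbours H i. b w) / ?d"
    using a(2) b(2) d by (subst (asm) ennreal_inj) (auto intro!: add_nonneg_nonneg divide_nonneg_nonneg sum_nonneg)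
  then show ?thesis using d by (simp add: field_simps)
qed


lemma capped_hitting_time_le_cap: "capped_hitting_time H c i j \<le> c"
proof -
  interpret W: prob_space "walk_space H" by (rule prob_space_walk_space[OF H no_isolated])
  have "capped_hitting_time H c i j \<le> (\<integral>\<^sup>+ \<omega>. c \<partial>walk_space H)"
    unfolding capped_hitting_time_def by (intro nn_integral_mono) simp
  then show ?thesis by (simp add: W.emeasure_space_1)
qed

lemma expected_hitting_time_eq_SUP:
  assumes i: "i \<in> pverts H"
  shows "expected_hitting_time H i j = (SUP N. capped_hitting_time H (of_nat N) i j)"
proof -
  have [measurable]: "hitting_time i j \<in> borel_measurable (walk_space H)"
    by (rule borel_hitting_time[OF i])
  have "(SUP N. min a (of_nat N)) = a" for a :: ennreal
  proof -
    have "inf a (SUP N. of_nat N) = (SUP N. inf a (of_nat N))" by (rule inf_SUP)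
    then show ?thesis by (simp add: ennreal_SUP_of_nat_eq_top inf_min)
  qed
  then have "expected_hitting_time H i j = (\<integral>\<^sup>+ \<omega>. (SUP N. min (hitting_time i j \<omega>) (of_nat N)) \<partial>walk_space H)"
    by (simp add: expected_hitting_time_def)
  also have "\<dots> = (SUP N. \<integral>\<^sup>+ \<omega>. min (hitting_time i j \<omega>) (of_nat N) \<partial>walk_space H)"
  proof (rule nn_integral_monotone_convergence_SUP)
    show "incseq (\<lambda>N \<omega>. min (hitting_time i j \<omega>) (of_nat N))"
      unfolding incseq_def le_fun_def by (intro allI impI min.mono order_refl of_nat_mono)
  qed measurable
  finally show ?thesis by (simp add: capped_hitting_time_def)
qed

text \<open>
  Capped hitting times \<open>g\<close> are increasing in the cap, so the first-step equation makes the Laplacian of \<open>g\<close> at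
  most the degree away from \<open>j\<close>. Summation by parts bounds the energy of \<open>g\<close> by its degree-weighted
  sum \<open>M\<close>, while the resistances bound \<open>g\<close> by \<open>sqrt (R M)\<close>. Together these bound \<open>M\<close> independently of the cap.
\<close>

lemma expected_hitting_time_bounded:
  assumes R: "\<And>u. u \<in> pverts H \<Longrightarrow> resistance_le H u j R" "0 \<le> R" and j: "j \<in> pverts H" and i: "i \<in> pverts H"
  shows "expected_hitting_time H i j \<le> ennreal ((real (card (parcs H)))\<^sup>2 * R)"
proof -
  let ?d = "\<lambda>v. real (vertex_degree H v)"
  let ?D = "real (card (parcs H))"
  have D: "?D = (\<Sum>v\<in>pverts H. ?d v)" by (simp add: card_parcs_eq_sum_degree[OF H])
  have fin: "finite (pverts H)" by (rule pair_graph_finite[OF H])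
  define g where "g N v = enn2real (capped_hitting_time H (of_nat N) v j)" for N v
  have g_nonneg: "0 \<le> g N v" for N v by (simp add: g_def)
  have g: "capped_hitting_time H (of_nat N) v j = ennreal (g N v)" for N v
  proof -
    have "capped_hitting_time H (of_nat N) v j < top"
      using capped_hitting_time_le_cap[of "of_nat N" v j] by (rule le_less_trans) (simp add: ennreal_of_nat_eq_real_of_nat)
    then show ?thesis by (simp add: g_def)
  qed
  have g_Suc: "g N v \<le> g (Suc N) v" for N v
    using capped_hitting_time_mono[of "of_nat N" "of_nat (Suc N)" H v j] g_nonneg
    by (simp add: g del: of_nat_Suc)
  have g_self: "g N j = 0" for N by (simp add: g_def capped_hitting_time_self)
  have "g N i \<le> ?D\<^sup>2 * R" for N
  proof -
    define M where "M = (\<Sum>v\<in>pverts H. ?d v * g N v)"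
    have lap: "laplacian H (g N) v \<le> ?d v" if v: "v \<in> pverts H" "v \<noteq> j" for v
    proof -
      have "?d v * g (Suc N) v = ?d v + (\<Sum>w\<in>neighbours H v. g N w)"
        using v g g_nonneg g[of "Suc N" v] by (intro capped_hitting_time_first_step_real[where c = "of_nat N"]) auto
      moreover have "?d v * g N v \<le> ?d v * g (Suc N) v"
        using g_Suc by (intro mult_left_mono) auto
      ultimately show ?thesis by (simp add: laplacian_eq[OF H])
    qed
    have "energy H (g N) = (\<Sum>v\<in>pverts H. g N v * laplacian H (g N) v)"
      by (rule energy_eq_sum_laplacian[OF H])
    also have "\<dots> \<le> (\<Sum>v\<in>pverts H. ?d v * g N v)"
    proof (rule sum_mono)
      fix v assume "v \<in> pverts H"
      then show "g N v * laplacian H (g N) v \<le> ?d v * g N v"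
        using lap[of v] g_nonneg[of N v] mult_left_mono[of "laplacian H (g N) v" "?d v" "g N v"]
        by (cases "v = j") (simp_all add: g_self mult.commute)
    qed
    finally have E: "energy H (g N) \<le> M" by (simp add: M_def)
    have M0: "0 \<le> M" unfolding M_def using g_nonneg by (intro sum_nonneg mult_nonneg_nonneg) auto
    have "g N v \<le> sqrt (R * M)" if v: "v \<in> pverts H" for v
    proof (rule real_le_rsqrt)
      have "(g N v - g N j)\<^sup>2 \<le> R * energy H (g N)"
        using R(1)[OF v] by (simp add: resistance_le_def)
      also have "\<dots> \<le> R * M" using E R(2) by (intro mult_left_mono)
      finally show "(g N v)\<^sup>2 \<le> R * M" by (simp add: g_self)
    qed
    then have "M \<le> (\<Sum>v\<in>pverts H. ?d v * sqrt (R * M))"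
      unfolding M_def by (intro sum_mono mult_left_mono) auto
    also have "\<dots> = ?D * sqrt (R * M)" by (simp add: D sum_distrib_right)
    finally have "M\<^sup>2 \<le> (?D * sqrt (R * M))\<^sup>2" using M0 by (intro power_mono)
    also have "\<dots> = (?D\<^sup>2 * R) * M" using R(2) M0 by (simp add: power_mult_distrib)
    finally have "M * M \<le> (?D\<^sup>2 * R) * M" by (simp add: power2_eq_square)
    then have "M \<le> ?D\<^sup>2 * R" using M0 R(2) by (cases "M = 0") (auto dest: mult_right_le_imp_le)
    moreover have "g N i \<le> M"
    proof -
      have "g N i \<le> ?d i * g N i"
        using vertex_degree_pos[OF i] g_nonneg[of N i] by (simp add: mult_le_cancel_right1)
      also have "\<dots> \<le> M" unfolding M_def
        using i fin g_nonneg by (intro member_le_sum) auto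
      finally show ?thesis .
    qed
    ultimately show ?thesis by linarith
  qed
  then show ?thesis
    unfolding expected_hitting_time_eq_SUP[OF i] g by (intro SUP_least ennreal_leI)
qed

end

section \<open>The bound on the constant\<close>

text \<open>The indicator function of a component has energy \<open>0\<close>.\<close>

lemma connected_if_resistance_le:
  assumes H: "pair_graph H" and V: "pverts H \<noteq> {}"
    and R: "\<And>u v. u \<in> pverts H \<Longrightarrow> v \<in> pverts H \<Longrightarrow> resistance_le H u v R"
  shows "Digraph_Component.connected (with_proj H)"
proof -
  let ?S = "with_proj (mk_symmetric (with_proj H))"
  have "(parcs H)\<inverse> \<subseteq> parcs H" using pair_graph_symD[OF H] by blast
  moreover have "arcs_ends ?S = parcs H \<union> (parcs H)\<inverse>"
    by (auto simp: parcs_mk_symmetric arcs_ends_conv)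
  ultimately have arcs: "arcs_ends ?S = parcs H" by blast
  have "u \<rightarrow>\<^sup>*\<^bsub>?S\<^esub> v" if u: "u \<in> pverts H" and v: "v \<in> pverts H" for u v
  proof (rule ccontr)
    assume not: "\<not> u \<rightarrow>\<^sup>*\<^bsub>?S\<^esub> v"
    define f :: "'a \<Rightarrow> real" where "f w = (if u \<rightarrow>\<^sup>*\<^bsub>?S\<^esub> w then 1 else 0)" for w
    have step: "u \<rightarrow>\<^sup>*\<^bsub>?S\<^esub> y" if "u \<rightarrow>\<^sup>*\<^bsub>?S\<^esub> x" "(x, y) \<in> parcs H" for x y
    proof -
      have "(u, x) \<in> rtrancl_on (verts ?S) (arcs_ends ?S)" "(x, y) \<in> arcs_ends ?S" "y \<in> verts ?S"
        using that pair_graph_arc_verts(2)[OF H that(2)] arcs by (simp_all add: reachable_def)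
      then show ?thesis unfolding reachable_def
        by (rule rtrancl_on_into_rtrancl_on)
    qed
    have "f x = f y" if "(x, y) \<in> parcs H" for x y
      using step[OF _ that] step[OF _ pair_graph_symD[OF H that]] by (auto simp: f_def)
    then have "energy H f = 0" by (auto simp: energy_def intro!: sum.neutral)
    moreover have "f u = 1" "f v = 0"
      using not u by (auto simp: f_def reachable_def)
    ultimately show False
      using R[OF u v] by (auto simp: resistance_le_def dest: spec[of _ f])
  qed
  then show ?thesis
    using V by (auto simp: Digraph_Component.connected_def strongly_connected_def)
qed

text \<open>
  Let \<open>D\<close> be the sum of the degrees and \<open>h i j\<close> the expected hitting time of \<open>j\<close> from \<open>i\<close>. The Laplacian of
  \<open>h _ j\<close> is the degree function, corrected by \<open>- D\<close> at \<open>j\<close> because a Laplacian sums to zero. Two consequences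
  are used. The difference \<open>h _ v - h _ u\<close> is \<open>D\<close> times the potential of a unit current from \<open>u\<close> to \<open>v\<close>, so
  commute times are at most \<open>D\<close> times the resistance. And the degree-weighted sum of the \<open>h _ j\<close>
  is harmonic, hence constant, so that it may be averaged over the starting vertex and symmetrised
  into commute times.
\<close>

lemma kemeny_le:
  assumes H: "pair_graph H" and n: "2 \<le> card (pverts H)" and good: "degree_bounded_resistances H"
  shows "kemeny H \<le> ennreal (10 * (real (card (pverts H)) - 1))"
proof -
  let ?V = "pverts H"
  let ?d = "\<lambda>v. real (vertex_degree H v)"
  let ?n = "real (card ?V)"
  define D where "D = real (card (parcs H))"
  have fin: "finite ?V" by (rule pair_graph_finite[OF H])
  have no_isolated: "neighbours H v \<noteq> {}" if "v \<in> ?V" for v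
    using good that by (simp add: degree_bounded_resistances_def)
  have r: "resistance_le H u v (10 * (1 / ?d u + 1 / ?d v))" if "u \<in> ?V" "v \<in> ?V" for u v
    using good that by (simp add: degree_bounded_resistances_def)
  have d: "1 \<le> ?d v" if "v \<in> ?V" for v
    using vertex_degree_pos[OF H no_isolated that] .
  have r20: "resistance_le H u v 20" if "u \<in> ?V" "v \<in> ?V" for u v
  proof -
    have "1 / ?d u \<le> 1" "1 / ?d v \<le> 1" using d[OF that(1)] d[OF that(2)] by (auto simp: divide_le_eq_1)
    then have "10 * (1 / ?d u + 1 / ?d v) \<le> 20" by simp
    then show ?thesis by (rule resistance_le_mono[OF r[OF that]])
  qed
  have D: "D = (\<Sum>v\<in>?V. ?d v)" by (simp add: D_def card_parcs_eq_sum_degree[OF H])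
  have "?n \<le> D" unfolding D using sum_mono[of ?V "\<lambda>_. 1" ?d] d by simp
  then have Dpos: "0 < D" using n by simp
  have V: "?V \<noteq> {}" using n by auto

  define h where "h i j = enn2real (expected_hitting_time H i j)" for i j
  have h_nonneg: "0 \<le> h i j" for i j by (simp add: h_def)
  have h: "expected_hitting_time H i j = ennreal (h i j)" if "i \<in> ?V" "j \<in> ?V" for i j
  proof -
    have "expected_hitting_time H i j \<le> ennreal ((real (card (parcs H)))\<^sup>2 * 20)"
      using that r20 by (intro expected_hitting_time_bounded[OF H no_isolated]) auto
    then have "expected_hitting_time H i j < top" by (rule le_less_trans) simp
    then show ?thesis by (simp add: h_def)
  qed
  have lap_h: "laplacian H (\<lambda>x. h x j) i = (if i = j then ?d i - D else ?d i)"
    if i: "i \<in> ?V" and j: "j \<in> ?V" for i j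
  proof -
    have off: "laplacian H (\<lambda>x. h x j) x = ?d x" if x: "x \<in> ?V" "x \<noteq> j" for x
    proof -
      have "?d x * h x j = ?d x + (\<Sum>w\<in>neighbours H x. h w j)"
        using x j h h_nonneg
        by (intro capped_hitting_time_first_step_real[OF H no_isolated, where c = top])
          (auto simp: uncapped_hitting_time)
      then show ?thesis by (simp add: laplacian_eq[OF H])
    qed
    have "0 = laplacian H (\<lambda>x. h x j) j + (\<Sum>x\<in>?V - {j}. laplacian H (\<lambda>x. h x j) x)"
      using sum_laplacian[OF H, of "\<lambda>x. h x j"] fin j by (simp add: sum.remove)
    also have "(\<Sum>x\<in>?V - {j}. laplacian H (\<lambda>x. h x j) x) = (\<Sum>x\<in>?V - {j}. ?d x)"
      using off by (intro sum.cong) auto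
    also have "\<dots> = D - ?d j" using fin j by (simp add: D sum.remove)
    finally show ?thesis using off[OF i] by auto
  qed

  have commute: "h u v + h v u \<le> 10 * (1 / ?d u + 1 / ?d v) * D"
    if u: "u \<in> ?V" and v: "v \<in> ?V" and uv: "u \<noteq> v" for u v
  proof -
    define g where "g x = h x v - h x u" for x
    define c where "c = h u v + h v u"
    have self: "h u u = 0" "h v v = 0"
      using capped_hitting_time_self[of H top]
      by (simp_all add: h_def uncapped_hitting_time)
    then have gc: "g u - g v = c" by (simp add: g_def c_def)
    have "laplacian H g x = laplacian H (\<lambda>x. h x v) x - laplacian H (\<lambda>x. h x u) x" for x
      unfolding g_def by (rule laplacian_diff)
    then have lap_g: "laplacian H g x = (if x = u then D else 0) - (if x = v then D else 0)" if "x \<in> ?V" for x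
      using that u v by (simp add: lap_h)
    have "energy H g = (\<Sum>x\<in>?V. g x * laplacian H g x)" by (rule energy_eq_sum_laplacian[OF H])
    also have "\<dots> = (\<Sum>x\<in>?V. (if x = u then D * g u else 0) - (if x = v then D * g v else 0))"
      using uv by (intro sum.cong) (auto simp: lap_g)
    also have "\<dots> = D * c" using u v fin gc by (simp add: sum_subtractf right_diff_distrib[symmetric])
    finally have "c\<^sup>2 \<le> 10 * (1 / ?d u + 1 / ?d v) * (D * c)"
      using r[OF u v] gc by (auto simp: resistance_le_def dest: spec[of _ g])
    then have "c * c \<le> (10 * (1 / ?d u + 1 / ?d v) * D) * c" by (simp add: power2_eq_square)
    moreover have "0 \<le> c" using h_nonneg by (simp add: c_def)
    ultimately have "c \<le> 10 * (1 / ?d u + 1 / ?d v) * D"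
      using Dpos by (cases "c = 0") (auto dest: mult_right_le_imp_le)
    then show ?thesis by (simp add: c_def)
  qed

  define k where "k x = (\<Sum>j\<in>?V. ?d j * h x j)" for x
  have lap_k: "laplacian H k x = 0" if x: "x \<in> ?V" for x
  proof -
    have "laplacian H k x = (\<Sum>y\<in>neighbours H x. \<Sum>j\<in>?V. ?d j * (h x j - h y j))"
      by (simp add: laplacian_def k_def sum_subtractf right_diff_distrib)
    also have "\<dots> = (\<Sum>j\<in>?V. ?d j * laplacian H (\<lambda>x. h x j) x)"
      by (subst sum.swap) (simp add: laplacian_def sum_distrib_left)
    also have "\<dots> = (\<Sum>j\<in>?V. ?d j * ?d x - (if j = x then ?d x * D else 0))"
      using x by (intro sum.cong) (auto simp: lap_h right_diff_distrib)
    also have "\<dots> = 0"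
      using x fin by (simp add: sum_subtractf sum_distrib_right[symmetric] D[symmetric] mult.commute)
    finally show ?thesis .
  qed
  have "energy H k = 0"
    using energy_eq_sum_laplacian[OF H, of k] lap_k by simp
  then have k_const: "k x = k y" if "x \<in> ?V" "y \<in> ?V" for x y
    using r20[OF that] by (auto simp: resistance_le_def dest: spec[of _ k])

  have k_le: "k i \<le> 10 * (?n - 1) * D" if i: "i \<in> ?V" for i
  proof -
    have "D * k i = (\<Sum>x\<in>?V. ?d x * k x)"
      using k_const[OF i] by (simp add: D sum_distrib_right)
    also have "\<dots> = (\<Sum>x\<in>?V. \<Sum>j\<in>?V. ?d x * ?d j * h x j)"
      by (simp add: k_def sum_distrib_left mult.assoc)
    finally have Dk: "D * k i = (\<Sum>x\<in>?V. \<Sum>j\<in>?V. ?d x * ?d j * h x j)" .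
    also have "\<dots> = (\<Sum>x\<in>?V. \<Sum>j\<in>?V. ?d x * ?d j * h j x)"
      by (subst sum.swap) (simp add: mult.commute)
    finally have "2 * (D * k i) = (\<Sum>x\<in>?V. \<Sum>j\<in>?V. ?d x * ?d j * (h x j + h j x))"
      using Dk by (simp add: sum.distrib distrib_left)
    also have "\<dots> \<le> (\<Sum>x\<in>?V. \<Sum>j\<in>?V. if j = x then 0 else 10 * D * (?d x + ?d j))"
    proof (intro sum_mono)
      fix x j assume x: "x \<in> ?V" and j: "j \<in> ?V"
      show "?d x * ?d j * (h x j + h j x) \<le> (if j = x then 0 else 10 * D * (?d x + ?d j))"
      proof (cases "j = x")
        case True
        then show ?thesis
          using capped_hitting_time_self[of H top x]
          by (simp add: h_def uncapped_hitting_time)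
      next
        case False
        have "?d x * ?d j * (h x j + h j x) \<le> ?d x * ?d j * (10 * (1 / ?d x + 1 / ?d j) * D)"
          using commute[OF x j] False by (intro mult_left_mono) auto
        also have "\<dots> = 10 * D * (?d x + ?d j)"
          using d[OF x] d[OF j] by (simp add: field_simps)
        finally show ?thesis using False by simp
      qed
    qed
    also have "\<dots> = (\<Sum>x\<in>?V. 10 * D * ((?n - 2) * ?d x + D))"
    proof (rule sum.cong)
      fix x assume x: "x \<in> ?V"
      have "(\<Sum>j\<in>?V. if j = x then 0 else 10 * D * (?d x + ?d j)) = (\<Sum>j\<in>?V - {x}. 10 * D * (?d x + ?d j))"
        using fin by (intro sum.mono_neutral_cong_right) auto
      also have "\<dots> = 10 * D * ((?n - 1) * ?d x + (D - ?d x))"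
        using fin x n by (simp add: sum_distrib_left[symmetric] sum.distrib D sum.remove[of _ x] of_nat_diff)
      also have "\<dots> = 10 * D * ((?n - 2) * ?d x + D)" by (simp add: algebra_simps)
      finally show "(\<Sum>j\<in>?V. if j = x then 0 else 10 * D * (?d x + ?d j)) = 10 * D * ((?n - 2) * ?d x + D)" .
    qed simp
    also have "\<dots> = 10 * D * ((?n - 2) * D + ?n * D)"
      by (simp only: sum_distrib_left[symmetric] sum.distrib D[symmetric] sum_constant)
    also have "\<dots> = 2 * (D * (10 * (?n - 1) * D))" by (simp add: algebra_simps)
    finally have "D * k i \<le> D * (10 * (?n - 1) * D)" by simp
    then show ?thesis using Dpos by (rule mult_left_le_imp_le)
  qed

  define i where "i = (SOME i. i \<in> ?V)"
  have i: "i \<in> ?V" unfolding i_def using V by (simp add: some_in_eq)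
  have "kemeny H = (\<Sum>j\<in>?V. ennreal (?d j / D) * expected_hitting_time H i j)"
    using connected_if_resistance_le[OF H V r20] by (simp add: kemeny_def i_def D_def Let_def)
  also have "\<dots> = (\<Sum>j\<in>?V. ennreal (?d j * h i j / D))"
    using h[OF i] Dpos h_nonneg by (intro sum.cong) (auto simp: ennreal_mult'[symmetric])
  also have "\<dots> = ennreal (k i / D)"
    using Dpos h_nonneg by (subst sum_ennreal) (auto simp: k_def sum_divide_distrib)
  also have "\<dots> \<le> ennreal (10 * (?n - 1))"
    using k_le[OF i] Dpos by (intro ennreal_leI) (simp add: pos_divide_le_eq)
  finally show ?thesis .
qed

lemma min_kemeny_le:
  assumes G: "pair_graph G" and n: "2 \<le> card (pverts G)"
  shows "min (kemeny G) (kemeny (complement_graph G)) \<le> ennreal (10 * (real (card (pverts G)) - 1))"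
  using degree_bounded_resistances_or_complement[OF G n] kemeny_le[OF G n]
    kemeny_le[OF pair_graph_complement_graph[OF G]] n
  by (auto simp: min_le_iff_disj)

theorem theorem5p6:
  shows "(\<forall>G :: 'a pair_pre_digraph. pair_graph G \<longrightarrow> 2 \<le> card (pverts G) \<longrightarrow>
            min (kemeny G) (kemeny (complement_graph G))
              \<le> ennreal ((8 + 2 * sqrt 5) * real (card (pverts G)) - (10 + 2 * sqrt 5)))
       \<and> (\<exists>C :: real. \<forall>G :: nat pair_pre_digraph. pair_graph G \<longrightarrow> 2 \<le> card (pverts G) \<longrightarrow>
            min (kemeny G) (kemeny (complement_graph G)) \<le> ennreal (C * real (card (pverts G))))"
proof (intro conjI exI[of _ 10] allI impI)
  fix G :: "'a pair_pre_digraph"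
  assume G: "pair_graph G" and n: "2 \<le> card (pverts G)"
  \<comment> \<open>The claimed bound is \<open>(8 + 2 * sqrt 5) * (n - 1) - 2\<close>, and the slack \<open>(2 * sqrt 5 - 2) * (n - 1)\<close> over
    \<open>10 * (n - 1)\<close> is at least \<open>2\<close>.\<close>
  have "2 \<le> sqrt 5" by (rule real_le_rsqrt) simp
  then have "2 * 1 \<le> (2 * sqrt 5 - 2) * (real (card (pverts G)) - 1)"
    using n by (intro mult_mono) auto
  then have "10 * (real (card (pverts G)) - 1)
      \<le> (8 + 2 * sqrt 5) * real (card (pverts G)) - (10 + 2 * sqrt 5)"
    by (simp add: algebra_simps)
  then show "min (kemeny G) (kemeny (complement_graph G))
      \<le> ennreal ((8 + 2 * sqrt 5) * real (card (pverts G)) - (10 + 2 * sqrt 5))"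
    by (intro order_trans[OF min_kemeny_le[OF G n]] ennreal_leI)
next
  fix G :: "nat pair_pre_digraph"
  assume G: "pair_graph G" and n: "2 \<le> card (pverts G)"
  show "min (kemeny G) (kemeny (complement_graph G)) \<le> ennreal (10 * real (card (pverts G)))"
    by (rule order_trans[OF min_kemeny_le[OF G n]]) (intro ennreal_leI, simp)
qed

end
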